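(* Let $d\ge1$ and assume that the environment is uniformly elliptic and i.i.d. If the support of $\mathbb{P}$ is not a singleton, then there exist interior points $\xi$ of $\mathcal{D}:=\{(\xi_1,\ldots,\xi_d)\in\mathbb{R}^d:|\xi_1|+\cdots+|\xi_d|\le1\}$ at which $I_a(\xi)<I_q(\xi)$, where $I_q$ and $I_a$ are the quenched and averaged large deviation rate functions of $X_n/n$.
   Context: Random walk in random environment (RWRE). Let $U=\{\pm e_i\}_{i=1}^d$, where $(e_i)$ is the canonical basis of $\mathbb{Z}^d$. An environment is $\omega=(\omega_x)_{x\in\mathbb{Z}^d}$, where $\omega_x=(\pi(x,x+z))_{z\in U}$ is a probability vector; $\Omega$ is the space of environments with the product topology and its Borel $\sigma$-algebra, and $\mathbb{P}$ is a probability measure on $\Omega$. Given $\omega$, $P_x^\omega$ is the law of the Markov chain $(X_n)_{n\ge0}$ on $\mathbb{Z}^d$ with $X_0=x$ and transition probability $\pi(y,y+z)$ from $y$ to $y+z$, $z\in U$. The averaged law is $P_x:=\mathbb{P}\times P_x^\omega$ (semi-direct product). The subscript $o$ denotes the origin. Uniformly elliptic: there is $\delta>0$ with $\mathbb{P}\{\pi(0,z)\ge\delta\}=1$ for every $z\in U$. I.i.d.: $(\omega_x)_{x\in\mathbb{Z}^d}$ is an i.i.d. collection under $\mathbb{P}$. A sequence $(Q_n)$ of probability measures on $\mathbb{R}^d$ satisfies the large deviation principle (LDP) with rate function $I$ if $I\ge 0$ is lower semicontinuous (with value $+\infty$ allowed) and $-\inf_{G^o}I\le\liminf\frac1n\log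 Q_n(G)\le\limsup\frac1n\log Q_n(G)\le-\inf_{\bar G}I$ for every measurable $G$. It is known that, for $\mathbb{P}$-a.e. $\omega$, $(P_o^\omega(X_n/n\in\cdot))_{n\ge1}$ satisfies the LDP with a deterministic convex rate function $I_q$ (quenched), and $(P_o(X_n/n\in\cdot))_{n\ge1}$ satisfies the LDP with a convex rate function $I_a$ (averaged). Both are finite exactly on $\mathcal{D}$. *)

theory Defs
  imports "HOL-Probability.Probability"
begin

type_synonym 'd site = "int ^ 'd"

definition unit_steps :: "'d::finite site set" where
  "unit_steps = {axis i 1 | i. True} \<union> {- axis i 1 | i. True}"

text \<open>An environment \<open>\<omega>\<close> is encoded by \<open>\<omega> x z = \<pi>(x, x + z)\<close>. As \<open>z\<close> ranges over the whole
  lattice rather than over \<^const>\<open>unit_steps\<close> only, the superfluous coordinates are set to \<open>0\<close>.\<close>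

type_synonym 'd env = "'d site \<Rightarrow> 'd site \<Rightarrow> real"

definition environments :: "'d::finite env set" where
  "environments = {\<omega>. \<forall>x. (\<forall>z\<in>unit_steps. 0 \<le> \<omega> x z) \<and> (\<Sum>z\<in>unit_steps. \<omega> x z) = 1 \<and>
     (\<forall>z. z \<notin> unit_steps \<longrightarrow> \<omega> x z = 0)}"

text \<open>Function types carry the product topology, so this is the Borel \<open>\<sigma>\<close>-algebra of the subspace
  \<^const>\<open>environments\<close>.\<close>

definition env_space :: "'d::finite env measure" where
  "env_space = restrict_space borel environments"

definition environment_law :: "'d::finite env measure \<Rightarrow> bool" where
  "environment_law P \<longleftrightarrow> prob_space P \<and> sets P = sets env_space"

definition uniformly_elliptic :: "'d::finite env measure \<Rightarrow> bool" where
  "uniformly_elliptic P \<longleftrightarrow>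
     (\<exists>\<delta>>0. \<forall>z\<in>unit_steps. measure P {\<omega> \<in> space P. \<delta> \<le> \<omega> 0 z} = 1)"

definition iid_environment :: "'d::finite env measure \<Rightarrow> bool" where
  "iid_environment P \<longleftrightarrow>
     prob_space.indep_vars P (\<lambda>_. borel) (\<lambda>x \<omega>. \<omega> x) UNIV \<and>
     (\<forall>x. distr P borel (\<lambda>\<omega>. \<omega> x) = distr P borel (\<lambda>\<omega>. \<omega> 0))"

definition topological_support :: "'a::topological_space measure \<Rightarrow> 'a set" where
  "topological_support M =
     {x \<in> space M. \<forall>V. open V \<longrightarrow> x \<in> V \<longrightarrow> 0 < emeasure M (V \<inter> space M)}"

definition transition :: "'d::finite env \<Rightarrow> 'd site \<Rightarrow> 'd site pmf" where
  "transition \<omega> y = embed_pmf (\<lambda>w. \<omega> y (w - y))"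

definition path_space :: "(nat \<Rightarrow> 'd::finite site) measure" where
  "path_space = (\<Pi>\<^sub>M n\<in>UNIV. count_space UNIV)"

text \<open>Conditional law of \<open>X n\<close> given \<open>X 0, \<dots>, X (n - 1)\<close> for the chain started at \<open>x\<close>; the path
  law is obtained from these kernels by the Ionescu-Tulcea theorem.\<close>

definition walk_kernel ::
  "'d::finite env \<Rightarrow> 'd site \<Rightarrow> nat \<Rightarrow> (nat \<Rightarrow> 'd site) \<Rightarrow> 'd site measure" where
  "walk_kernel \<omega> x n X =
     measure_pmf (case n of 0 \<Rightarrow> return_pmf x | Suc m \<Rightarrow> transition \<omega> (X m))"

definition quenched_law :: "'d::finite env \<Rightarrow> 'd site \<Rightarrow> (nat \<Rightarrow> 'd site) measure" where
  "quenched_law \<omega> x =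
     projective_family.lim UNIV
       (Ionescu_Tulcea.CI (walk_kernel \<omega> x) (\<lambda>_. count_space UNIV)) (\<lambda>_. count_space UNIV)"

text \<open>The semi-direct product \<open>P \<times> P\<^sub>x\<^sup>\<omega>\<close>, a measure on pairs of an environment and a path.\<close>

definition averaged_law ::
  "'d::finite env measure \<Rightarrow> 'd site \<Rightarrow> ('d env \<times> (nat \<Rightarrow> 'd site)) measure" where
  "averaged_law P x =
     P \<bind> (\<lambda>\<omega>. distr (quenched_law \<omega> x) (P \<Otimes>\<^sub>M path_space) (\<lambda>X. (\<omega>, X)))"

text \<open>For \<open>n = 0\<close> the value is \<open>0\<close>; this does not affect large deviations.\<close>

definition velocity :: "nat \<Rightarrow> (nat \<Rightarrow> 'd::finite site) \<Rightarrow> real ^ 'd" where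
  "velocity n X = (\<chi> i. real_of_int (X n $ i) / real n)"

definition quenched_velocity :: "'d::finite env \<Rightarrow> nat \<Rightarrow> (real ^ 'd) measure" where
  "quenched_velocity \<omega> n = distr (quenched_law \<omega> 0) borel (velocity n)"

definition averaged_velocity :: "'d::finite env measure \<Rightarrow> nat \<Rightarrow> (real ^ 'd) measure" where
  "averaged_velocity P n = distr (averaged_law P 0) borel (\<lambda>(\<omega>, X). velocity n X)"

definition log_ereal :: "real \<Rightarrow> ereal" where
  "log_ereal p = (if p = 0 then -\<infinity> else ereal (ln p))"

definition rate_function :: "('a::topological_space \<Rightarrow> ereal) \<Rightarrow> bool" where
  "rate_function I \<longleftrightarrow> (\<forall>x. 0 \<le> I x) \<and> (\<forall>x. I x \<le> Liminf (at x) I)"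

definition LDP :: "(nat \<Rightarrow> 'a::topological_space measure) \<Rightarrow> ('a \<Rightarrow> ereal) \<Rightarrow> bool" where
  "LDP Q I \<longleftrightarrow> rate_function I \<and>
     (\<forall>G\<in>sets borel.
        - (INF x\<in>interior G. I x) \<le> liminf (\<lambda>n. ereal (1 / real n) * log_ereal (measure (Q n) G)) \<and>
        limsup (\<lambda>n. ereal (1 / real n) * log_ereal (measure (Q n) G)) \<le> - (INF x\<in>closure G. I x))"

definition convex_ereal :: "('a::real_vector \<Rightarrow> ereal) \<Rightarrow> bool" where
  "convex_ereal I \<longleftrightarrow>
     (\<forall>x y. \<forall>t\<in>{0..1}. I ((1 - t) *\<^sub>R x + t *\<^sub>R y) \<le> ereal (1 - t) * I x + ereal t * I y)"

text \<open>Rate functions of an LDP on \<open>real ^ 'd\<close> are unique, so the next two predicates determine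
  \<open>I\<^sub>q\<close> and \<open>I\<^sub>a\<close>. The quenched one is chosen before \<open>\<omega>\<close>, i.e. deterministic.\<close>

definition quenched_rate_function ::
  "'d::finite env measure \<Rightarrow> (real ^ 'd \<Rightarrow> ereal) \<Rightarrow> bool" where
  "quenched_rate_function P I \<longleftrightarrow> convex_ereal I \<and> (AE \<omega> in P. LDP (quenched_velocity \<omega>) I)"

definition averaged_rate_function ::
  "'d::finite env measure \<Rightarrow> (real ^ 'd \<Rightarrow> ereal) \<Rightarrow> bool" where
  "averaged_rate_function P I \<longleftrightarrow> convex_ereal I \<and> LDP (averaged_velocity P) I"

definition velocity_domain :: "(real ^ 'd::finite) set" where
  "velocity_domain = {\<xi>. (\<Sum>i\<in>UNIV. \<bar>\<xi> $ i\<bar>) \<le> 1}"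

lemma finite_unit_steps: "finite (unit_steps :: 'd::finite site set)"
  unfolding unit_steps_def by (auto simp: full_SetCompr_eq)

lemma pmf_transition:
  assumes "\<omega> \<in> environments"
  shows "pmf (transition \<omega> y) w = \<omega> y (w - y)"
proof -
  have nn: "0 \<le> \<omega> y z" for z
    using assms unfolding environments_def by (cases "z \<in> unit_steps") auto
  have "(\<integral>\<^sup>+ w. ennreal (\<omega> y (w - y)) \<partial>count_space UNIV) =
      (\<integral>\<^sup>+ z. ennreal (\<omega> y z) \<partial>count_space UNIV)"
    by (rule nn_integral_bij_count_space)
      (auto intro!: bij_betw_byWitness[where f'="\<lambda>z. z + y"])
  also have "\<dots> = (\<Sum>z\<in>unit_steps. ennreal (\<omega> y z))"
    using assms unfolding environments_def
    by (intro nn_integral_count_space'[OF finite_unit_steps]) auto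
  also have "\<dots> = ennreal (\<Sum>z\<in>unit_steps. \<omega> y z)"
    using nn by (simp add: sum_ennreal)
  also have "\<dots> = 1"
    using assms by (simp add: environments_def)
  finally have "(\<integral>\<^sup>+ w. ennreal (\<omega> y (w - y)) \<partial>count_space UNIV) = 1" .
  with nn show ?thesis
    unfolding transition_def by (intro pmf_embed_pmf)
qed

lemma walk_Ionescu_Tulcea: "Ionescu_Tulcea (walk_kernel \<omega> x) (\<lambda>_. count_space UNIV)"
proof (rule Ionescu_Tulcea.intro)
  fix n
  show "walk_kernel \<omega> x n \<in>
      measurable (PiM {0..<n} (\<lambda>_. count_space UNIV)) (subprob_algebra (count_space UNIV))"
  proof (cases n)
    case 0
    then show ?thesis by (simp add: walk_kernel_def[abs_def] measure_pmf_in_subprob_algebra)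
  next
    case (Suc m)
    have [measurable]: "(\<lambda>X. X m) \<in>
        measurable (PiM {0..<Suc m} (\<lambda>_. count_space UNIV)) (count_space (UNIV :: 'a site set))"
      by (rule measurable_component_singleton) simp
    have [measurable]: "(\<lambda>y. measure_pmf (transition \<omega> y)) \<in>
        measurable (count_space UNIV) (subprob_algebra (count_space UNIV))"
      by (auto intro: measure_pmf_in_subprob_algebra)
    show ?thesis unfolding Suc walk_kernel_def[abs_def] by simp
  qed
next
  fix n and X :: "nat \<Rightarrow> 'a site"
  show "prob_space (walk_kernel \<omega> x n X)"
    unfolding walk_kernel_def by (rule prob_space_measure_pmf)
qed

lemma sets_quenched_law: "sets (quenched_law \<omega> x) = sets path_space"
proof -
  interpret Ionescu_Tulcea "walk_kernel \<omega> x" "\<lambda>_. count_space UNIV" by (rule walk_Ionescu_Tulcea)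
  show ?thesis by (simp add: quenched_law_def path_space_def)
qed

lemma emeasure_quenched_law_kernel:
  "emeasure (quenched_law \<omega> x) {X. \<forall>i\<le>n. X i = p i} =
     (\<Prod>i\<le>n. emeasure (walk_kernel \<omega> x i p) {p i})"
proof -
  let ?M = "\<lambda>_::nat. count_space (UNIV :: 'a site set)"
  interpret Ionescu_Tulcea "walk_kernel \<omega> x" ?M by (rule walk_Ionescu_Tulcea)
  have single[measurable]: "{restrict p {0..<k}} \<in> sets (PiM {0..<k} ?M)" for k
  proof -
    have "{restrict p {0..<k}} = PiE {0..<k} (\<lambda>i. {p i})"
      by (auto simp: PiE_iff extensional_def restrict_def)
    then show ?thesis by simp
  qed
  have *: "emeasure (C 0 k (\<lambda>_. undefined)) {restrict p {0..<k}} =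
      (\<Prod>i<k. emeasure (walk_kernel \<omega> x i p) {p i})" for k
  proof (induction k)
    case 0
    have "restrict p {} = (\<lambda>_. undefined)" by auto
    then show ?case
      using single[of 0] by (simp add: emeasure_return)
  next
    case (Suc k)
    have sp: "space (C 0 k (\<lambda>_. undefined)) = space (PiM {0..<k} ?M)"
      by (subst space_C) auto
    have st: "sets (C 0 k (\<lambda>_. undefined)) = sets (PiM {0..<k} ?M)"
      by (subst sets_C) auto
    have ne: "space (C 0 k (\<lambda>_. undefined)) \<noteq> {}"
      unfolding sp by (auto simp: space_PiM_empty_iff)
    have "emeasure (C 0 (Suc k) (\<lambda>_. undefined)) {restrict p {0..<Suc k}} =
        (\<integral>\<^sup>+ w. emeasure (eP k w) {restrict p {0..<Suc k}} \<partial>C 0 k (\<lambda>_. undefined))"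
      using measurable_eP[of k] single[of "Suc k"]
      by (simp, intro emeasure_bind[OF ne, where N = "PiM {0..<Suc k} ?M"])
        (simp_all add: measurable_cong_sets[OF st refl])
    also have "\<dots> = (\<integral>\<^sup>+ w. emeasure (walk_kernel \<omega> x k p) {p k} * indicator {restrict p {0..<k}} w
        \<partial>C 0 k (\<lambda>_. undefined))"
    proof (rule nn_integral_cong)
      fix w assume "w \<in> space (C 0 k (\<lambda>_. undefined))"
      then have w: "w \<in> space (PiM {0..<k} ?M)" by (simp add: sp)
      then have ext: "w i = undefined" if "\<not> i < k" for i
        using that by (auto simp: space_PiM PiE_iff extensional_def)
      show "emeasure (eP k w) {restrict p {0..<Suc k}} =
          emeasure (walk_kernel \<omega> x k p) {p k} * indicator {restrict p {0..<k}} w"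
      proof (cases "w = restrict p {0..<k}")
        case True
        have "(\<lambda>y. w(k := y)) -` {restrict p {0..<Suc k}} = {p k}"
          unfolding True by (auto simp: fun_eq_iff restrict_def less_Suc_eq split: if_splits)
        moreover have "walk_kernel \<omega> x k w = walk_kernel \<omega> x k p"
          unfolding True walk_kernel_def by (auto split: nat.split)
        ultimately show ?thesis
          using True emeasure_eP[OF w single[of "Suc k"]] by simp
      next
        case False
        then obtain i where i: "w i \<noteq> restrict p {0..<k} i" by (auto simp: fun_eq_iff)
        then have "i < k" using ext[of i] by (auto simp: restrict_def split: if_splits)
        with i have "(\<lambda>y. w(k := y)) -` {restrict p {0..<Suc k}} = {}"
          by (auto dest!: fun_cong[of _ _ i] simp: restrict_def)
        then show ?thesis
          using False emeasure_eP[OF w single[of "Suc k"]] by simp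
      qed
    qed
    also have "\<dots> = emeasure (walk_kernel \<omega> x k p) {p k} *
        emeasure (C 0 k (\<lambda>_. undefined)) {restrict p {0..<k}}"
      using single[of k] st by (intro nn_integral_cmult_indicator) simp
    finally show ?case
      unfolding Suc by (simp only: prod.lessThan_Suc mult.commute)
  qed
  have "{X. \<forall>i\<le>n. X i = p i} = PF.emb UNIV {0..<Suc n} {restrict p {0..<Suc n}}"
  proof (intro set_eqI iffI)
    fix X assume "X \<in> {X. \<forall>i\<le>n. X i = p i}"
    then show "X \<in> PF.emb UNIV {0..<Suc n} {restrict p {0..<Suc n}}"
      by (auto simp: prod_emb_def space_PiM less_Suc_eq_le intro!: restrict_ext)
  next
    fix X assume "X \<in> PF.emb UNIV {0..<Suc n} {restrict p {0..<Suc n}}"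
    then have "restrict X {0..<Suc n} = restrict p {0..<Suc n}" by (simp add: prod_emb_def)
    then have "restrict X {0..<Suc n} i = restrict p {0..<Suc n} i" for i by simp
    then have "i \<le> n \<Longrightarrow> X i = p i" for i by (metis atLeastLessThan_iff le0 less_Suc_eq_le restrict_apply')
    then show "X \<in> {X. \<forall>i\<le>n. X i = p i}" by blast
  qed
  then have "emeasure (quenched_law \<omega> x) {X. \<forall>i\<le>n. X i = p i} =
      emeasure (CI {0..<Suc n}) {restrict p {0..<Suc n}}"
    unfolding quenched_law_def by (simp only: lim[OF _ single] finite_atLeastLessThan)
  also have "\<dots> = emeasure (C 0 (Suc n) (\<lambda>_. undefined)) {restrict p {0..<Suc n}}"
  proof -
    have "PF.emb {0..<Suc n} {0..<Suc n} {restrict p {0..<Suc n}} = {restrict p {0..<Suc n}}"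
      by (rule prod_emb_id) auto
    then show ?thesis
      using emeasure_CI[of "{0..<Suc n}" "Suc n", OF _ single] by simp
  qed
  finally show ?thesis by (simp only: * lessThan_Suc_atMost)
qed

lemma emeasure_quenched_law:
  assumes "\<omega> \<in> environments"
  shows "emeasure (quenched_law \<omega> x) {X. \<forall>i\<le>n. X i = p i} =
     (if p 0 = x then ennreal (\<Prod>i<n. \<omega> (p i) (p (Suc i) - p i)) else 0)"
proof -
  have nn: "0 \<le> \<omega> y z" for y z
    using assms unfolding environments_def by (cases "z \<in> unit_steps") auto
  have "(\<Prod>i\<le>n. emeasure (walk_kernel \<omega> x i p) {p i}) =
      (if p 0 = x then 1 else 0) * (\<Prod>i<n. ennreal (\<omega> (p i) (p (Suc i) - p i)))"
    by (simp add: prod.atMost_shift walk_kernel_def emeasure_pmf_single pmf_transition[OF assms])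
  then show ?thesis
    unfolding emeasure_quenched_law_kernel using nn by (simp add: prod_ennreal)
qed

lemma prob_space_quenched_law: "prob_space (quenched_law \<omega> x)"
proof -
  interpret Ionescu_Tulcea "walk_kernel \<omega> x" "\<lambda>_. count_space UNIV" by (rule walk_Ionescu_Tulcea)
  interpret CI0: prob_space "CI {}" by (rule PF.prob_space_P) auto
  have "emeasure PF.lim (PF.emb UNIV {} {\<lambda>_. undefined}) = emeasure (CI {}) {\<lambda>_. undefined}"
    by (rule lim) (auto simp: PiM_empty)
  also have "\<dots> = 1"
    using CI0.emeasure_space_1 by (simp add: CI_def space_PiM_empty)
  also have "PF.emb UNIV {} {\<lambda>_. undefined} = space PF.lim"
    by (auto simp: prod_emb_def space_PiM)
  finally show ?thesis unfolding quenched_law_def by (rule prob_spaceI)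
qed

lemma space_env_space: "space env_space = environments"
  by (simp add: env_space_def space_restrict_space)

lemma measurable_env_coordinate[measurable]: "(\<lambda>\<omega>. \<omega> x z) \<in> borel_measurable env_space"
proof -
  have "continuous_on UNIV (\<lambda>\<omega> :: 'a env. \<omega> x z)"
    by (rule continuous_on_product_then_coordinatewise[OF continuous_on_product_coordinates])
  then show ?thesis
    unfolding env_space_def
    by (intro measurable_restrict_space1 borel_measurable_continuous_onI)
qed

lemma measurable_quenched_law:
  "(\<lambda>\<omega>. quenched_law \<omega> x) \<in> measurable env_space (prob_algebra path_space)"
proof -
  define cyl :: "(nat \<Rightarrow> 'a site) set set"
    where "cyl = insert {} {{X. \<forall>i\<le>n. X i = p i} | n p. True}"
  have comp: "{X. X i = a} \<in> sigma_sets UNIV cyl" for i and a :: "'a site"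
  proof -
    have "{X. X i = a} = (\<Union>l\<in>{l. length l = i}. {X. \<forall>j\<le>i. X j = (l @ [a]) ! j})" (is "_ = ?U")
    proof (intro set_eqI iffI)
      fix X assume X: "X \<in> {X. X i = a}"
      have "X j = (map X [0..<i] @ [a]) ! j" if "j \<le> i" for j
        using X that by (cases "j = i") (simp_all add: nth_append)
      then show "X \<in> ?U" by (intro UN_I[of "map X [0..<i]"]) simp_all
    next
      fix X assume "X \<in> ?U"
      then obtain l where l: "length l = i" and X: "\<forall>j\<le>i. X j = (l @ [a]) ! j"
        by blast
      from X have "X i = (l @ [a]) ! i" by blast
      with l show "X \<in> {X. X i = a}" by (simp add: nth_append)
    qed
    also have "\<dots> \<in> sigma_sets UNIV cyl"
    proof (rule sigma_sets_UNION)
      show "countable ((\<lambda>l. {X. \<forall>j\<le>i. X j = (l @ [a]) ! j}) ` {l. length l = i})"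
        by (intro countable_image) simp
    next
      fix B assume "B \<in> (\<lambda>l. {X. \<forall>j\<le>i. X j = (l @ [a]) ! j}) ` {l. length l = i}"
      then have "B \<in> cyl" unfolding cyl_def by blast
      then show "B \<in> sigma_sets UNIV cyl" by (rule sigma_sets.Basic)
    qed
    finally show ?thesis .
  qed
  have sets_eq: "sets (path_space :: (nat \<Rightarrow> 'a site) measure) = sigma_sets UNIV cyl"
  proof (rule antisym)
    have "(\<lambda>X. X) \<in> measurable (sigma UNIV cyl) (path_space :: (nat \<Rightarrow> 'a site) measure)"
      unfolding path_space_def
    proof (rule measurable_PiM_single')
      fix i :: nat
      show "(\<lambda>X. X i) \<in> measurable (sigma UNIV cyl) (count_space (UNIV :: 'a site set))"
        by (subst measurable_count_space_eq_countable)
          (auto simp: vimage_def comp)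
    qed (auto simp: space_PiM)
    from measurable_sets[OF this] show "sets path_space \<subseteq> sigma_sets UNIV cyl"
      by auto
  next
    have "cyl \<subseteq> sets path_space"
    proof
      fix A assume "A \<in> cyl"
      then consider "A = {}" | n p where "A = {X. \<forall>i\<le>n. X i = p i}" by (auto simp: cyl_def)
      then show "A \<in> sets path_space"
      proof cases
        case 2
        have "A = (\<Pi>\<^sub>E i\<in>UNIV. if i \<le> n then {p i} else UNIV)"
          unfolding 2 by (auto simp: PiE_iff split: if_splits)
        then show ?thesis
          unfolding path_space_def by (auto intro!: sets_PiM_I_countable)
      qed simp
    qed
    then show "sigma_sets UNIV cyl \<subseteq> sets (path_space :: (nat \<Rightarrow> 'a site) measure)"
      using sets.sigma_sets_subset[of cyl path_space] by (simp add: path_space_def space_PiM)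
  qed
  have stable: "Int_stable cyl"
  proof (rule Int_stableI)
    have *: "{X. \<forall>i\<le>n. X i = p i} \<inter> {X. \<forall>i\<le>m. X i = q i} \<in> cyl" if "n \<le> m"
      for n m and p q :: "nat \<Rightarrow> 'a site"
    proof (cases "\<forall>i\<le>n. q i = p i")
      case True
      then have "{X. \<forall>i\<le>n. X i = p i} \<inter> {X. \<forall>i\<le>m. X i = q i} = {X. \<forall>i\<le>m. X i = q i}"
        using order_trans[OF _ that] by fastforce
      then show ?thesis unfolding cyl_def by blast
    next
      case False
      then obtain i where "i \<le> n" "q i \<noteq> p i" by blast
      moreover from this that have "i \<le> m" by simp
      ultimately have "X i = p i \<Longrightarrow> X i = q i \<Longrightarrow> False" for X by simp
      with \<open>i \<le> n\<close> \<open>i \<le> m\<close>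
      have "{X. \<forall>i\<le>n. X i = p i} \<inter> {X. \<forall>i\<le>m. X i = q i} = {}" by blast
      then show ?thesis unfolding cyl_def by simp
    qed
    fix A B assume AB: "A \<in> cyl" "B \<in> cyl"
    show "A \<inter> B \<in> cyl"
    proof (cases "A = {} \<or> B = {}")
      case True then show ?thesis by (auto simp: cyl_def)
    next
      case False
      with AB obtain n p m q where "A = {X. \<forall>i\<le>n. X i = p i}" "B = {X. \<forall>i\<le>m. X i = q i}"
        by (auto simp: cyl_def)
      then show ?thesis
        using *[of n m p q] *[of m n q p] by (metis Int_commute nat_le_linear)
    qed
  qed
  show ?thesis
  proof (rule measurable_prob_algebra_generated[OF sets_eq stable])
    fix A assume "A \<in> cyl"
    then consider "A = {}" | n p where "A = {X. \<forall>i\<le>n. X i = p i}" by (auto simp: cyl_def)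
    then show "(\<lambda>\<omega>. emeasure (quenched_law \<omega> x) A) \<in> borel_measurable env_space"
    proof cases
      case 2
      show ?thesis unfolding 2
        by (subst measurable_cong[OF emeasure_quenched_law])
          (auto simp: space_env_space)
    qed simp
  qed (auto simp: prob_space_quenched_law sets_quenched_law)
qed

lemma measurable_joint_kernel:
  assumes "environment_law P"
  shows "(\<lambda>\<omega>. distr (quenched_law \<omega> x) (P \<Otimes>\<^sub>M path_space) (\<lambda>X. (\<omega>, X))) \<in>
    measurable P (subprob_algebra (P \<Otimes>\<^sub>M path_space))"
proof (rule measurable_distr2[where M = path_space])
  show "(\<lambda>(\<omega>, X). (\<omega>, X)) \<in> measurable (P \<Otimes>\<^sub>M path_space) (P \<Otimes>\<^sub>M path_space)"
    by simp
  have "sets P = sets env_space"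
    using assms by (simp add: environment_law_def)
  then have "(\<lambda>\<omega>. quenched_law \<omega> x) \<in> measurable P (prob_algebra path_space)"
    using measurable_quenched_law by (simp cong: measurable_cong_sets)
  then show "(\<lambda>\<omega>. quenched_law \<omega> x) \<in> measurable P (subprob_algebra path_space)"
    by (rule measurable_prob_algebraD)
qed

lemma emeasure_averaged_law:
  assumes P: "environment_law P" and A: "A \<in> sets (P \<Otimes>\<^sub>M path_space)"
  shows "emeasure (averaged_law P x) A =
    (\<integral>\<^sup>+\<omega>. emeasure (quenched_law \<omega> x) {X. (\<omega>, X) \<in> A} \<partial>P)"
proof -
  interpret prob_space P using P by (simp add: environment_law_def)
  have "emeasure (averaged_law P x) A =
      (\<integral>\<^sup>+\<omega>. emeasure (distr (quenched_law \<omega> x) (P \<Otimes>\<^sub>M path_space) (\<lambda>X. (\<omega>, X))) A \<partial>P)"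
    unfolding averaged_law_def
    by (rule emeasure_bind[OF not_empty measurable_joint_kernel[OF P] A])
  also have "\<dots> = (\<integral>\<^sup>+\<omega>. emeasure (quenched_law \<omega> x) {X. (\<omega>, X) \<in> A} \<partial>P)"
  proof (rule nn_integral_cong)
    fix \<omega> assume "\<omega> \<in> space P"
    then have "(\<lambda>X. (\<omega>, X)) \<in> measurable (quenched_law \<omega> x) (P \<Otimes>\<^sub>M path_space)"
      by (simp add: measurable_cong_sets[OF sets_quenched_law refl])
    moreover have "space (quenched_law \<omega> x) = UNIV"
      using sets_eq_imp_space_eq[OF sets_quenched_law] by (simp add: path_space_def space_PiM)
    ultimately show "emeasure (distr (quenched_law \<omega> x) (P \<Otimes>\<^sub>M path_space) (\<lambda>X. (\<omega>, X))) A =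
        emeasure (quenched_law \<omega> x) {X. (\<omega>, X) \<in> A}"
      using A by (simp add: emeasure_distr vimage_def)
  qed
  finally show ?thesis .
qed

end

theory Submission
  imports Defs
begin

text \<open>At a unit step \<open>z\<close>, a boundary point of the domain, the walk has to go straight and sees a new
  site at every step. Hence \<open>I\<^sub>a z \<le> - ln (E \<pi>(0, z))\<close>, whereas bounding the mean of the square root of
  the quenched probability over nearly straight paths and applying the Borel-Cantelli lemma gives
  \<open>I\<^sub>q z \<ge> - 2 ln (E (sqrt \<pi>(0, z)))\<close>. The latter bound is strictly larger as soon as \<open>\<pi>(0, z)\<close> is
  not almost surely constant, and such a step exists unless the environment is deterministic.
  Finally \<open>I\<^sub>a\<close> is convex and finite at \<open>- z\<close> and \<open>z\<close> while \<open>I\<^sub>q\<close> is lower semicontinuous, so the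
  strict inequality persists at \<open>t z\<close> for \<open>t < 1\<close> close to \<open>1\<close>.\<close>

subsection \<open>Unit steps and the level along a step\<close>

text \<open>For a unit step \<open>z\<close> this is the signed coordinate in direction
  \<open>z\<close>. It is integer-valued, so a path whose steps have level at most 1 cannot skip a
  value on its way up.\<close>

definition level :: "'d::finite site \<Rightarrow> 'd site \<Rightarrow> int" where
  "level z x = (\<Sum>i\<in>UNIV. z $ i * x $ i)"

definition real_site :: "'d::finite site \<Rightarrow> real ^ 'd" where
  "real_site x = (\<chi> i. real_of_int (x $ i))"

lemma level_zero [simp]: "level z 0 = 0"
  by (simp add: level_def)

lemma level_add: "level z (x + y) = level z x + level z y"
  by (simp add: level_def distrib_left sum.distrib)

lemma level_sum: "level z (\<Sum>j\<in>A. f j) = (\<Sum>j\<in>A. level z (f j))"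
  by (induction A rule: infinite_finite_induct) (simp_all add: level_add)

lemma level_minus_left: "level (- z) x = - level z x"
  by (simp add: level_def sum_negf)

lemma level_axis: "level (axis i 1) x = x $ i"
  by (simp add: level_def axis_def if_distrib[of "\<lambda>a. a * _"] cong: if_cong)

lemma unit_stepsE:
  assumes "z \<in> unit_steps"
  obtains i where "z = axis i 1" | i where "z = - axis i 1"
  using assms unfolding unit_steps_def by blast

lemma uminus_unit_steps: "z \<in> unit_steps \<Longrightarrow> - z \<in> unit_steps"
  by (auto simp: unit_steps_def)

lemma level_self: "z \<in> unit_steps \<Longrightarrow> level z z = 1"
  by (erule unit_stepsE) (auto simp: level_minus_left level_axis)

lemma level_unit_step_le:
  assumes "z \<in> unit_steps" "s \<in> unit_steps"
  shows "level z s \<le> 1"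
  using assms
  by (elim unit_stepsE) (simp_all add: level_minus_left level_axis, simp_all add: axis_def)

text \<open>Every increase of the level is thus due to the step \<open>z\<close> itself. This
  produces the factors \<open>\<omega> y z\<close> in the weight of a path, and it bounds the tilted
  weight of each other step by \<open>1 / K\<close>.\<close>

lemma level_unit_step_eq_1:
  assumes "z \<in> unit_steps" "s \<in> unit_steps" "level z s = 1"
  shows "s = z"
  using assms
  by (elim unit_stepsE)
    (simp_all add: level_minus_left level_axis, simp_all add: axis_def split: if_splits)

lemma inner_real_site: "real_site x \<bullet> real_site z = real_of_int (level z x)"
  by (simp add: inner_vec_def real_site_def level_def mult.commute)

lemma velocity_eq_scaled: "velocity n X = (1 / real n) *\<^sub>R real_site (X n)"
  by (simp add: velocity_def real_site_def vec_eq_iff)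

lemma real_site_uminus: "real_site (- z) = - real_site z"
  by (simp add: real_site_def vec_eq_iff)

lemma sum_abs_real_site: "z \<in> unit_steps \<Longrightarrow> (\<Sum>i\<in>UNIV. \<bar>real_site z $ i\<bar>) = 1"
  by (erule unit_stepsE) (simp_all add: real_site_def axis_def if_distrib[of "real_of_int"]
     if_distrib[of "abs"] if_distrib[of uminus] cong: if_cong)

lemma scaled_unit_step_in_interior:
  assumes "z \<in> unit_steps" "\<bar>t\<bar> < 1"
  shows "t *\<^sub>R real_site z \<in> interior velocity_domain"
proof (rule interiorI)
  show "open {\<xi> :: real ^ 'a. (\<Sum>i\<in>UNIV. \<bar>\<xi> $ i\<bar>) < 1}"
    by (intro open_Collect_less continuous_intros)
  have "(\<Sum>i\<in>UNIV. \<bar>(t *\<^sub>R real_site z) $ i\<bar>) = \<bar>t\<bar>"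
    using sum_abs_real_site[OF assms(1)] by (simp add: abs_mult flip: sum_distrib_left)
  then show "t *\<^sub>R real_site z \<in> {\<xi>. (\<Sum>i\<in>UNIV. \<bar>\<xi> $ i\<bar>) < 1}"
    using assms(2) by simp
qed (auto simp: velocity_domain_def)

subsection \<open>Environments with independent sites\<close>

lemma environment_nonneg: "\<omega> \<in> environments \<Longrightarrow> 0 \<le> \<omega> x z"
  by (cases "z \<in> unit_steps") (auto simp: environments_def)

lemma environment_le_1:
  assumes "\<omega> \<in> environments" shows "\<omega> x z \<le> 1"
proof (cases "z \<in> unit_steps")
  case True
  have "\<omega> x z \<le> (\<Sum>z\<in>unit_steps. \<omega> x z)"
    using True assms by (intro member_le_sum) (auto simp: finite_unit_steps environment_nonneg)
  then show ?thesis using assms by (simp add: environments_def)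
qed (use assms in \<open>auto simp: environments_def\<close>)

lemma space_environment_law: "environment_law P \<Longrightarrow> space P = environments"
  by (metis environment_law_def sets_eq_imp_space_eq space_env_space)

lemma measurable_coordinate_environment_law:
  "environment_law P \<Longrightarrow> (\<lambda>\<omega>. \<omega> x z) \<in> borel_measurable P"
  using measurable_env_coordinate[of x z] unfolding environment_law_def
  by (simp cong: measurable_cong_sets)

text \<open>Equality of laws is assumed for the whole vector at a site. Evaluation at
  \<open>z\<close> is continuous, so pushing forward under it transfers the equality to single
  entries.\<close>

lemma distr_coordinate_eq:
  assumes "environment_law P" "iid_environment P"
  shows "distr P borel (\<lambda>\<omega>. \<omega> x z) = distr P borel (\<lambda>\<omega>. \<omega> 0 z)"
proof -
  interpret prob_space P using assms by (simp add: environment_law_def)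
  have [measurable]: "(\<lambda>\<omega>. \<omega> y) \<in> measurable P borel" for y
    using assms(2) by (simp add: iid_environment_def indep_vars_def)
  have [measurable]: "(\<lambda>v :: 'a site \<Rightarrow> real. v z) \<in> borel_measurable borel"
    by (intro borel_measurable_continuous_onI continuous_on_product_coordinates)
  have "distr P borel (\<lambda>\<omega>. \<omega> y z) = distr (distr P borel (\<lambda>\<omega>. \<omega> y)) borel (\<lambda>v. v z)" for y
    by (simp add: distr_distr comp_def)
  moreover have "distr P borel (\<lambda>\<omega>. \<omega> x) = distr P borel (\<lambda>\<omega>. \<omega> 0)"
    using assms(2) unfolding iid_environment_def by blast
  ultimately show ?thesis by metis
qed

text \<open>\<open>Y\<close> is a set, so each site enters once and the factors are independent. The
  lemma is applied with the square root for the quenched estimate and with the identity for the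
  averaged one.\<close>

lemma iid_expectation_prod:
  fixes f :: "real \<Rightarrow> real"
  assumes P: "environment_law P" "iid_environment P"
    and f[measurable]: "f \<in> borel_measurable borel"
    and int: "integrable P (\<lambda>\<omega>. f (\<omega> 0 z))" and Y: "finite Y"
  shows "integrable P (\<lambda>\<omega>. \<Prod>y\<in>Y. f (\<omega> y z))"
    and "(\<integral>\<omega>. (\<Prod>y\<in>Y. f (\<omega> y z)) \<partial>P) = (\<integral>\<omega>. f (\<omega> 0 z) \<partial>P) ^ card Y"
proof -
  interpret prob_space P using P by (simp add: environment_law_def)
  note [measurable] = measurable_coordinate_environment_law[OF P(1)]
  have "(\<lambda>v :: 'a site \<Rightarrow> real. v z) \<in> borel_measurable borel"
    by (intro borel_measurable_continuous_onI continuous_on_product_coordinates)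
  then have [measurable]: "(\<lambda>v :: 'a site \<Rightarrow> real. f (v z)) \<in> borel_measurable borel"
    by simp
  have ind: "indep_vars (\<lambda>_. borel) (\<lambda>y \<omega>. f (\<omega> y z)) Y"
  proof -
    have "indep_vars (\<lambda>_. borel) (\<lambda>x (\<omega> :: 'a env). \<omega> x) Y"
      using P(2) unfolding iid_environment_def by (blast intro: indep_vars_subset)
    from indep_vars_compose2[OF this, of "\<lambda>_ v. f (v z)" "\<lambda>_. borel"] show ?thesis by simp
  qed
  have intd: "integrable (distr P borel (\<lambda>\<omega>. \<omega> y z)) f" for y
    unfolding distr_coordinate_eq[OF P, of y] using int by (subst integrable_distr_eq) auto
  have inty: "integrable P (\<lambda>\<omega>. f (\<omega> y z))" for y
    using intd[of y] by (subst (asm) integrable_distr_eq) auto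
  have eq: "(\<integral>\<omega>. f (\<omega> y z) \<partial>P) = (\<integral>\<omega>. f (\<omega> 0 z) \<partial>P)" for y
    using distr_coordinate_eq[OF P, of y z]
    by (metis integral_distr[OF measurable_coordinate_environment_law[OF P(1)] f])
  show "integrable P (\<lambda>\<omega>. \<Prod>y\<in>Y. f (\<omega> y z))"
    using inty ind Y by (intro indep_vars_integrable) auto
  have "(\<integral>\<omega>. (\<Prod>y\<in>Y. f (\<omega> y z)) \<partial>P) = (\<Prod>y\<in>Y. \<integral>\<omega>. f (\<omega> y z) \<partial>P)"
    by (rule indep_vars_lebesgue_integral[OF Y ind inty])
  also have "\<dots> = (\<Prod>y\<in>Y. \<integral>\<omega>. f (\<omega> 0 z) \<partial>P)"
    by (rule prod.cong[OF refl eq])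
  finally show "(\<integral>\<omega>. (\<Prod>y\<in>Y. f (\<omega> y z)) \<partial>P) = (\<integral>\<omega>. f (\<omega> 0 z) \<partial>P) ^ card Y"
    by simp
qed

text \<open>Used in contrapositive form: a support that is not a singleton rules out an almost
  surely constant environment.\<close>

lemma topological_support_point_mass:
  assumes P: "environment_law P" and ae: "AE \<omega> in P. \<omega> = \<omega>'"
  shows "topological_support P = {\<omega>'}"
proof -
  interpret prob_space P using P by (simp add: environment_law_def)
  \<comment> \<open>A statement free of \<open>\<omega>\<close> that holds almost everywhere under a
    probability measure is true, so \<open>\<omega>'\<close> is itself an environment.\<close>
  have "AE \<omega> in P. \<omega>' \<in> space P"
    using ae AE_space by eventually_elim auto
  then have sp: "\<omega>' \<in> space P" by simp
  have em: "emeasure P (V \<inter> space P) = indicator V \<omega>'" if "open V" for V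
  proof -
    have "V \<inter> space P \<in> sets P"
      using P that by (simp add: environment_law_def env_space_def space_environment_law sets_restrict_space Int_commute)
    then have "emeasure P (V \<inter> space P) = (\<integral>\<^sup>+\<omega>. indicator V \<omega>' \<partial>P)"
      using ae sp by (subst nn_integral_indicator[symmetric], simp, intro nn_integral_cong_AE)
        (auto split: split_indicator)
    then show ?thesis by (simp add: emeasure_space_1)
  qed
  show ?thesis
  proof (intro set_eqI iffI)
    fix \<omega> assume supp: "\<omega> \<in> topological_support P"
    \<comment> \<open>If some coordinate differed, the open set where it differs from that of
      \<open>\<omega>'\<close> would be a neighbourhood of \<open>\<omega>\<close> of mass
      zero.\<close>
    have "\<omega> x z = \<omega>' x z" for x z
    proof (rule ccontr)
      assume "\<omega> x z \<noteq> \<omega>' x z"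
      moreover have "continuous_on UNIV (\<lambda>\<omega> :: 'a env. \<omega> x z)"
        by (rule continuous_on_product_then_coordinatewise[OF continuous_on_product_coordinates])
      then have "open {\<omega> :: 'a env. \<omega> x z \<noteq> \<omega>' x z}"
        by (intro open_Collect_neq) auto
      ultimately show False
        using supp em[of "{\<omega>. \<omega> x z \<noteq> \<omega>' x z}"] by (auto simp: topological_support_def)
    qed
    then show "\<omega> \<in> {\<omega>'}" by auto
  qed (use sp em in \<open>auto simp: topological_support_def\<close>)
qed

subsection \<open>Paths of the quenched walk\<close>

text \<open>Paths from the origin are described by their increments: those of length
  \<open>n\<close> form the finite product \<open>PiE {..<n} (\<lambda>_. unit_steps)\<close>, and
  the sum over it of a product of one-step weights factorises.\<close>

definition position :: "(nat \<Rightarrow> 'd::finite site) \<Rightarrow> nat \<Rightarrow> 'd site" where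
  "position s i = (\<Sum>j<i. s j)"

lemma position_0 [simp]: "position s 0 = 0"
  by (simp add: position_def)

lemma position_Suc: "position s (Suc i) = position s i + s i"
  by (simp add: position_def)

lemma space_quenched_law: "space (quenched_law \<omega> x) = UNIV"
  using sets_eq_imp_space_eq[OF sets_quenched_law] by (simp add: path_space_def space_PiM)

lemma sets_cylinder: "{X. \<forall>i\<le>n. X i = p i} \<in> sets (quenched_law \<omega> x)"
proof -
  have [measurable]: "(\<lambda>X. X i) \<in> measurable path_space (count_space UNIV)" for i :: nat
    unfolding path_space_def by (rule measurable_component_singleton) simp
  have "{X \<in> space path_space. \<forall>i\<in>{..n}. X i = p i} \<in> sets path_space"
    by measurable
  then show ?thesis by (simp add: sets_quenched_law path_space_def space_PiM Ball_def)
qed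

lemma sets_path_event: "{X. R (X n)} \<in> sets (quenched_law \<omega> x)"
proof -
  have [measurable]: "(\<lambda>X. X n) \<in> measurable path_space (count_space UNIV)"
    unfolding path_space_def by (rule measurable_component_singleton) simp
  have "{X \<in> space path_space. R (X n)} \<in> sets path_space"
    by measurable
  then show ?thesis by (simp add: sets_quenched_law path_space_def space_PiM)
qed

text \<open>A union bound over the finitely many increment sequences that realise the event. All
  other trajectories lie in a countable union of cylinders of mass zero.\<close>

lemma emeasure_quenched_law_le_sum_paths:
  fixes \<omega> :: "'d::finite env"
  assumes \<omega>: "\<omega> \<in> environments"
  shows "emeasure (quenched_law \<omega> 0) {X. R (X n)} \<le>
    (\<Sum>s | s \<in> PiE {..<n} (\<lambda>_. unit_steps) \<and> R (position s n).
      ennreal (\<Prod>i<n. \<omega> (position s i) (s i)))"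
proof -
  let ?M = "quenched_law \<omega> 0"
  define S where "S = {s \<in> PiE {..<n} (\<lambda>_. unit_steps). R (position s n)}"
  define L where "L = {l :: 'd site list. \<not> (l ! 0 = 0 \<and> (\<forall>i<n. l ! Suc i - l ! i \<in> unit_steps))}"
  define C where "C p = {X. \<forall>i\<le>n. X i = p i}" for p :: "nat \<Rightarrow> 'd site"
  have C[measurable]: "C p \<in> sets ?M" for p
    unfolding C_def by (rule sets_cylinder)
  have [simp]: "finite S"
    unfolding S_def
    by (rule finite_subset[of _ "PiE {..<n} (\<lambda>_. unit_steps)"])
      (auto intro!: finite_PiE simp: finite_unit_steps)
  have null: "(\<Union>l\<in>L. C (nth l)) \<in> null_sets ?M"
  proof (rule null_sets_UN')
    fix l assume l: "l \<in> L"
    have "emeasure ?M (C (nth l)) = 0"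
    proof (cases "l ! 0 = 0")
      case True
      with l obtain i where "i < n" "l ! Suc i - l ! i \<notin> unit_steps" by (auto simp: L_def)
      with \<omega> have "\<exists>i<n. \<omega> (l ! i) (l ! Suc i - l ! i) = 0" by (auto simp: environments_def)
      then have eq: "(\<Prod>i<n. \<omega> (l ! i) (l ! Suc i - l ! i)) = 0" by (auto intro: prod_zero)
      show ?thesis unfolding C_def emeasure_quenched_law[OF \<omega>] eq by simp
    qed (simp add: C_def emeasure_quenched_law[OF \<omega>])
    then show "C (nth l) \<in> null_sets ?M" by auto
  qed simp
  have "{X. R (X n)} \<subseteq> (\<Union>s\<in>S. C (position s)) \<union> (\<Union>l\<in>L. C (nth l))"
  proof
    fix X assume X: "X \<in> {X. R (X n)}"
    show "X \<in> (\<Union>s\<in>S. C (position s)) \<union> (\<Union>l\<in>L. C (nth l))"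
    proof (cases "X 0 = 0 \<and> (\<forall>i<n. X (Suc i) - X i \<in> unit_steps)")
      case True
      define s where "s = restrict (\<lambda>i. X (Suc i) - X i) {..<n}"
      have pos: "position s i = X i" if "i \<le> n" for i
        using that True by (induction i) (auto simp: position_Suc s_def)
      with True X have "s \<in> S" by (auto simp: S_def s_def)
      moreover have "X \<in> C (position s)" using pos by (simp add: C_def)
      ultimately show ?thesis by blast
    next
      case False
      define l where "l = map X [0..<Suc n]"
      have l: "l ! i = X i" if "i \<le> n" for i
        using that unfolding l_def by (subst nth_map) (auto simp del: upt_Suc)
      with False have "l \<in> L" by (auto simp: L_def)
      moreover have "X \<in> C (nth l)" using l by (simp add: C_def)
      ultimately show ?thesis by blast
    qed
  qed
  then have "emeasure ?M {X. R (X n)} \<le> emeasure ?M ((\<Union>s\<in>S. C (position s)) \<union> (\<Union>l\<in>L. C (nth l)))"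
    using null_setsD2[OF null] \<open>finite S\<close>
    by (intro emeasure_mono sets.Un) (auto intro!: sets.finite_UN)
  also have "\<dots> = emeasure ?M (\<Union>s\<in>S. C (position s))"
    using null by (intro emeasure_Un_null_set) auto
  also have "\<dots> \<le> (\<Sum>s\<in>S. emeasure ?M (C (position s)))"
    by (intro emeasure_subadditive_finite) auto
  also have "\<dots> = (\<Sum>s\<in>S. ennreal (\<Prod>i<n. \<omega> (position s i) (s i)))"
    unfolding C_def emeasure_quenched_law[OF \<omega>] by (simp add: position_Suc)
  finally show ?thesis by (simp add: S_def)
qed

text \<open>The path must cross from level \<open>k\<close> to level \<open>k + 1\<close> for each \<open>k\<close> below its final level, and only
  the step \<open>z\<close> does this; the crossing points are distinct as their levels are.\<close>

lemma path_weight_le_prod_distinct_sites: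
  fixes s :: "nat \<Rightarrow> 'd::finite site"
  assumes s: "s \<in> PiE {..<n} (\<lambda>_. unit_steps)" and z: "z \<in> unit_steps"
  obtains Y where "finite Y" "card Y = nat (level z (position s n))"
    "\<And>\<omega>. \<omega> \<in> environments \<Longrightarrow> (\<Prod>i<n. \<omega> (position s i) (s i)) \<le> (\<Prod>y\<in>Y. \<omega> y z)"
proof -
  \<comment> \<open>\<open>nat\<close> turns a negative final level into \<open>0\<close>; the set
    of sites is then empty and the bound only says that the weight is at most 1.\<close>
  define m where "m = nat (level z (position s n))"
  have "\<exists>i<n. level z (position s i) = int k \<and> s i = z" if "k < m" for k
  proof -
    \<comment> \<open>\<open>Max A\<close> is the last time up to \<open>n\<close> at level at most
      \<open>k\<close>. The final level exceeds \<open>k\<close>, so the next step leads above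
      \<open>k\<close>; as a step gains at most one level, it goes from \<open>k\<close> to
      \<open>k + 1\<close>.\<close>
    define A where "A = {j. j \<le> n \<and> level z (position s j) \<le> int k}"
    have fin: "finite A" unfolding A_def by simp
    have "0 \<in> A" by (simp add: A_def)
    then have "Max A \<in> A" using fin by (intro Max_in) auto
    moreover have "n \<notin> A" using that by (auto simp: A_def m_def)
    ultimately have i: "Max A < n" "level z (position s (Max A)) \<le> int k"
      by (auto simp: A_def order_less_le)
    have "Suc (Max A) \<notin> A" using Max_ge[OF fin, of "Suc (Max A)"] by auto
    with i have up: "level z (position s (Suc (Max A))) > int k" by (auto simp: A_def)
    have unit: "s (Max A) \<in> unit_steps" using s i by auto
    from up i level_unit_step_le[OF z unit]
    have "level z (s (Max A)) = 1" "level z (position s (Max A)) = int k"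
      by (auto simp: position_Suc level_add)
    with i level_unit_step_eq_1[OF z unit] show ?thesis by blast
  qed
  then obtain g where g: "\<And>k. k < m \<Longrightarrow> g k < n"
      "\<And>k. k < m \<Longrightarrow> level z (position s (g k)) = int k" "\<And>k. k < m \<Longrightarrow> s (g k) = z"
    by metis
  define I where "I = g ` {..<m}"
  have inj_pos: "inj_on (position s) I"
    unfolding I_def inj_on_def using g(2) by (metis imageE lessThan_iff of_nat_eq_iff)
  have inj_g: "inj_on g {..<m}"
    unfolding inj_on_def using g(2) by (metis lessThan_iff of_nat_eq_iff)
  have I: "finite I" "I \<subseteq> {..<n}" "card I = m"
    using g(1) inj_g by (auto simp: I_def card_image)
  show thesis
  proof
    show "finite (position s ` I)" using I by simp
    show "card (position s ` I) = nat (level z (position s n))"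
      using I inj_pos by (simp add: card_image m_def)
    fix \<omega> :: "'d env" assume \<omega>: "\<omega> \<in> environments"
    note nn = environment_nonneg[OF \<omega>] environment_le_1[OF \<omega>]
    \<comment> \<open>The factors at times outside \<open>I\<close> are at most 1 and get
      dropped.\<close>
    have "(\<Prod>i<n. \<omega> (position s i) (s i)) =
        (\<Prod>i\<in>{..<n} - I. \<omega> (position s i) (s i)) * (\<Prod>i\<in>I. \<omega> (position s i) (s i))"
      using I by (intro prod.subset_diff) auto
    also have "\<dots> \<le> 1 * (\<Prod>i\<in>I. \<omega> (position s i) (s i))"
      using nn by (intro mult_right_mono prod_le_1 prod_nonneg) auto
    also have "\<dots> = (\<Prod>i\<in>I. \<omega> (position s i) z)"
      using g(3) by (auto simp: I_def intro!: prod.cong)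
    also have "\<dots> = (\<Prod>y\<in>position s ` I. \<omega> y z)"
      using inj_pos by (simp add: prod.reindex)
    finally show "(\<Prod>i<n. \<omega> (position s i) (s i)) \<le> (\<Prod>y\<in>position s ` I. \<omega> y z)" .
  qed
qed

text \<open>Subadditivity of the square root, by induction from two terms. It moves the root from a
  total probability to single paths, where it distributes over the product of transition
  probabilities.\<close>

lemma sqrt_sum_le:
  assumes "\<And>i. i \<in> A \<Longrightarrow> 0 \<le> f i"
  shows "sqrt (\<Sum>i\<in>A. f i) \<le> (\<Sum>i\<in>A. sqrt (f i))"
  using assms
proof (induction A rule: infinite_finite_induct)
  case (insert x F)
  have "sqrt (\<Sum>i\<in>insert x F. f i) \<le> sqrt (f x) + sqrt (\<Sum>i\<in>F. f i)"
    using insert by (simp add: sqrt_add_le_add_sqrt sum_nonneg)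
  with insert show ?case by force
qed auto

lemma sqrt_prod: "sqrt (\<Prod>i\<in>A. f i) = (\<Prod>i\<in>A. sqrt (f i))"
  by (induction A rule: infinite_finite_induct) (auto simp: real_sqrt_mult)

text \<open>The weight \<open>K powr (level z u - 1)\<close> per step \<open>u\<close> penalises all steps but \<open>z\<close>.\<close>

lemma card_directed_paths_le:
  fixes z :: "'d::finite site"
  assumes z: "z \<in> unit_steps" and K: "1 \<le> K"
  shows "real (card {s \<in> PiE {..<n} (\<lambda>_. unit_steps).
      (1 - \<epsilon>) * real n < real_of_int (level z (position s n))}) \<le>
    (K powr \<epsilon> * (1 + real (card (unit_steps :: 'd site set)) / K)) ^ n"
proof -
  define Q where "Q = PiE {..<n} (\<lambda>_. unit_steps :: 'd site set)"
  define S where "S = {s \<in> Q. (1 - \<epsilon>) * real n < real_of_int (level z (position s n))}"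
  define w where "w u = K powr (real_of_int (level z u) - 1)" for u
  have [simp]: "finite Q" unfolding Q_def by (auto intro!: finite_PiE simp: finite_unit_steps)
  have w_prod: "(\<Prod>i<n. w (s i)) = K powr (real_of_int (level z (position s n)) - real n)" for s
    unfolding w_def position_def level_sum using K
    by (subst powr_sum[symmetric]) (auto simp: sum_subtractf)
  have "real (card S) = (\<Sum>s\<in>S. 1)" by simp
  \<comment> \<open>A Chernoff-type bound: on \<open>S\<close> the total exponent of
    \<open>K\<close> is nonnegative and \<open>1 \<le> K\<close>, so each summand is at least
    1.\<close>
  also have "\<dots> \<le> (\<Sum>s\<in>S. K powr (\<epsilon> * real n) * (\<Prod>i<n. w (s i)))"
  proof (rule sum_mono)
    fix s assume "s \<in> S"
    then have "0 \<le> \<epsilon> * real n + (real_of_int (level z (position s n)) - real n)"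
      by (simp add: S_def algebra_simps)
    then show "1 \<le> K powr (\<epsilon> * real n) * (\<Prod>i<n. w (s i))"
      unfolding w_prod using K by (simp add: ge_one_powr_ge_zero flip: powr_add)
  qed
  also have "\<dots> \<le> (\<Sum>s\<in>Q. K powr (\<epsilon> * real n) * (\<Prod>i<n. w (s i)))"
    by (intro sum_mono2) (auto simp: S_def w_def intro!: mult_nonneg_nonneg prod_nonneg)
  also have "\<dots> = K powr (\<epsilon> * real n) * (\<Prod>i<n. \<Sum>u\<in>unit_steps. w u)"
    unfolding Q_def by (subst prod_sum_PiE) (auto simp: finite_unit_steps sum_distrib_left)
  also have "\<dots> = (K powr \<epsilon> * (\<Sum>u\<in>unit_steps. w u)) ^ n"
    using K by (simp add: powr_mult_base power_mult_distrib powr_powr[symmetric] powr_realpow)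
  also have "\<dots> \<le> (K powr \<epsilon> * (1 + real (card (unit_steps :: 'd site set)) / K)) ^ n"
  proof (intro power_mono mult_left_mono)
    have "(\<Sum>u\<in>unit_steps. w u) = w z + (\<Sum>u\<in>unit_steps - {z}. w u)"
      using z by (intro sum.remove) (auto simp: finite_unit_steps)
    also have "w z = 1" using z K by (simp add: w_def level_self)
    also have "(\<Sum>u\<in>unit_steps - {z}. w u) \<le> (\<Sum>u\<in>unit_steps - {z}. 1 / K)"
    proof (rule sum_mono)
      \<comment> \<open>The level of \<open>u\<close> is an integer different from 1 and at most 1,
        hence at most \<open>0\<close>.\<close>
      fix u assume u: "u \<in> unit_steps - {z}"
      then have "level z u \<noteq> 1" "level z u \<le> 1"
        using level_unit_step_eq_1[OF z] level_unit_step_le[OF z] by auto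
      then have "w u \<le> K powr (-1)" unfolding w_def using K by (intro powr_mono) auto
      then show "w u \<le> 1 / K" using K by (simp add: powr_minus_divide)
    qed
    also have "\<dots> \<le> (\<Sum>u\<in>(unit_steps :: 'd site set). 1 / K)"
      using K by (intro sum_mono2) (auto simp: finite_unit_steps)
    finally show "(\<Sum>u\<in>unit_steps. w u) \<le> 1 + real (card (unit_steps :: 'd site set)) / K"
      by simp
  qed (auto intro!: mult_nonneg_nonneg sum_nonneg simp: w_def)
  finally show ?thesis by (simp add: S_def Q_def)
qed

subsection \<open>Lower bound for the quenched rate at a unit step\<close>

lemma measurable_quenched_event:
  assumes "environment_law P"
  shows "(\<lambda>\<omega>. measure (quenched_law \<omega> x) {X. R (X n)}) \<in> borel_measurable P"
proof -
  have "(\<lambda>\<omega>. quenched_law \<omega> x) \<in> measurable P (prob_algebra path_space)"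
    using assms measurable_quenched_law unfolding environment_law_def
    by (simp cong: measurable_cong_sets)
  then have "(\<lambda>\<omega>. quenched_law \<omega> x) \<in> measurable P (subprob_algebra path_space)"
    by (rule measurable_prob_algebraD)
  moreover have "{X. R (X n)} \<in> sets path_space"
    using sets_path_event[of R n] by (simp add: sets_quenched_law)
  ultimately show ?thesis
    by (rule measurable_compose[OF _ measurable_measure_subprob_algebra])
qed

lemma integrable_of_unit_interval:
  assumes P: "environment_law P" and f: "f \<in> borel_measurable P"
    and "\<And>\<omega>. \<omega> \<in> environments \<Longrightarrow> 0 \<le> f \<omega> \<and> f \<omega> \<le> (1::real)"
  shows "integrable P f"
proof -
  interpret prob_space P using P by (simp add: environment_law_def)
  show ?thesis
    using assms by (intro integrable_const_bound[where B = 1] AE_I2) (auto simp: space_environment_law)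
qed

lemma integrable_coordinate:
  assumes P: "environment_law P"
  shows "integrable P (\<lambda>\<omega>. \<omega> x z)" "integrable P (\<lambda>\<omega>. sqrt (\<omega> x z))"
  using measurable_coordinate_environment_law[OF P, of x z]
  by (auto intro!: integrable_of_unit_interval[OF P] simp: environment_nonneg environment_le_1)

lemma integrable_sqrt_quenched_event:
  assumes P: "environment_law P"
  shows "integrable P (\<lambda>\<omega>. sqrt (measure (quenched_law \<omega> x) {X. R (X n)}))"
  using measurable_quenched_event[OF P, of x R n]
  by (auto intro!: integrable_of_unit_interval[OF P] prob_space.prob_le_1[OF prob_space_quenched_law])

lemma expectation_sqrt_coordinate_le_1:
  assumes P: "environment_law P"
  shows "(\<integral>\<omega>. sqrt (\<omega> x z) \<partial>P) \<le> 1"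
proof -
  interpret prob_space P using P by (simp add: environment_law_def)
  have "(\<integral>\<omega>. sqrt (\<omega> x z) \<partial>P) \<le> (\<integral>\<omega>. 1 \<partial>P)"
    using space_environment_law[OF P] integrable_coordinate[OF P]
    by (intro integral_mono) (auto simp: environment_le_1)
  then show ?thesis by (simp add: prob_space)
qed

text \<open>Taking square roots before averaging turns the union bound over paths into a product of
  independent factors with mean \<open>r\<close>, whose growth rate \<open>2 ln r\<close> lies below the averaged one.\<close>

lemma expectation_sqrt_directed_le:
  fixes P :: "'d::finite env measure"
  assumes P: "environment_law P" "iid_environment P" and z: "z \<in> unit_steps" and K: "1 \<le> K"
  defines "r \<equiv> \<integral>\<omega>. sqrt (\<omega> 0 z) \<partial>P"
  assumes r: "0 < r"
  shows "(\<integral>\<omega>. sqrt (measure (quenched_law \<omega> 0)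
      {X. (1 - \<epsilon>) * real n < real_of_int (level z (X n))}) \<partial>P) \<le>
    (K powr \<epsilon> * (1 + real (card (unit_steps :: 'd site set)) / K) * r powr (1 - \<epsilon>)) ^ n"
proof -
  interpret prob_space P using P by (simp add: environment_law_def)
  define S where "S = {s \<in> PiE {..<n} (\<lambda>_. unit_steps).
      (1 - \<epsilon>) * real n < real_of_int (level z (position s n))}"
  let ?E = "{X :: nat \<Rightarrow> 'd site. (1 - \<epsilon>) * real n < real_of_int (level z (X n))}"
  \<comment> \<open>The set \<open>Y\<close> depends on the path but not on the environment, so the
    mean of the product over it can be computed by independence.\<close>
  have "\<forall>s\<in>S. \<exists>Y. finite Y \<and> card Y = nat (level z (position s n)) \<and>
      (\<forall>\<omega>\<in>environments. (\<Prod>i<n. \<omega> (position s i) (s i)) \<le> (\<Prod>y\<in>Y. \<omega> y z))"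
  proof
    fix s assume "s \<in> S"
    then have "s \<in> PiE {..<n} (\<lambda>_. unit_steps)" by (simp add: S_def)
    from path_weight_le_prod_distinct_sites[OF this z] show "\<exists>Y. finite Y \<and> card Y = nat (level z (position s n)) \<and>
      (\<forall>\<omega>\<in>environments. (\<Prod>i<n. \<omega> (position s i) (s i)) \<le> (\<Prod>y\<in>Y. \<omega> y z))"
      by metis
  qed
  from bchoice[OF this] obtain Y where Y: "\<And>s. s \<in> S \<Longrightarrow> finite (Y s)"
      "\<And>s. s \<in> S \<Longrightarrow> card (Y s) = nat (level z (position s n))"
      "\<And>s \<omega>. s \<in> S \<Longrightarrow> \<omega> \<in> environments \<Longrightarrow>
        (\<Prod>i<n. \<omega> (position s i) (s i)) \<le> (\<Prod>y\<in>Y s. \<omega> y z)"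
    by auto
  have prod: "integrable P (\<lambda>\<omega>. \<Prod>y\<in>Y s. sqrt (\<omega> y z))"
      "(\<integral>\<omega>. (\<Prod>y\<in>Y s. sqrt (\<omega> y z)) \<partial>P) = r ^ card (Y s)" if "s \<in> S" for s
    using iid_expectation_prod[OF P borel_measurable_sqrt integrable_coordinate(2)[OF P(1)] Y(1)[OF that]]
    by (simp_all add: r_def)
  have pointwise: "sqrt (measure (quenched_law \<omega> 0) ?E) \<le> (\<Sum>s\<in>S. \<Prod>y\<in>Y s. sqrt (\<omega> y z))"
    if \<omega>: "\<omega> \<in> environments" for \<omega>
  proof -
    interpret Q: prob_space "quenched_law \<omega> 0" by (rule prob_space_quenched_law)
    have nn: "0 \<le> (\<Prod>i<n. \<omega> (position s i) (s i))" for s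
      by (intro prod_nonneg) (auto simp: environment_nonneg[OF \<omega>])
    have "ennreal (measure (quenched_law \<omega> 0) ?E) \<le> ennreal (\<Sum>s\<in>S. \<Prod>i<n. \<omega> (position s i) (s i))"
      using emeasure_quenched_law_le_sum_paths[OF \<omega>, of "\<lambda>x. (1 - \<epsilon>) * real n < real_of_int (level z x)" n] nn
      by (simp add: S_def Q.emeasure_eq_measure sum_ennreal)
    then have "measure (quenched_law \<omega> 0) ?E \<le> (\<Sum>s\<in>S. \<Prod>i<n. \<omega> (position s i) (s i))"
      using nn by (subst (asm) ennreal_le_iff) (auto intro: sum_nonneg)
    also have "\<dots> \<le> (\<Sum>s\<in>S. \<Prod>y\<in>Y s. \<omega> y z)"
      using Y(3) \<omega> by (intro sum_mono) auto
    finally have "sqrt (measure (quenched_law \<omega> 0) ?E) \<le> sqrt (\<Sum>s\<in>S. \<Prod>y\<in>Y s. \<omega> y z)"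
      by simp
    also have "\<dots> \<le> (\<Sum>s\<in>S. sqrt (\<Prod>y\<in>Y s. \<omega> y z))"
      by (intro sqrt_sum_le prod_nonneg) (auto simp: environment_nonneg[OF \<omega>])
    finally show ?thesis by (simp add: sqrt_prod)
  qed
  have "(\<integral>\<omega>. sqrt (measure (quenched_law \<omega> 0) ?E) \<partial>P) \<le>
      (\<integral>\<omega>. (\<Sum>s\<in>S. \<Prod>y\<in>Y s. sqrt (\<omega> y z)) \<partial>P)"
    using prod(1) pointwise integrable_sqrt_quenched_event[OF P(1)] space_environment_law[OF P(1)]
    by (intro integral_mono) auto
  also have "\<dots> = (\<Sum>s\<in>S. r ^ card (Y s))"
    using prod by (subst Bochner_Integration.integral_sum) auto
  \<comment> \<open>As \<open>r \<le> 1\<close>, powers of \<open>r\<close> decrease in the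
    exponent, and \<open>card (Y s)\<close> is at least \<open>(1 - \<epsilon>) * n\<close> on
    \<open>S\<close>.\<close>
  also have "\<dots> \<le> (\<Sum>s\<in>S. r powr ((1 - \<epsilon>) * real n))"
  proof (rule sum_mono)
    fix s assume s: "s \<in> S"
    then have "(1 - \<epsilon>) * real n \<le> real (card (Y s))"
      using Y(2) by (auto simp: S_def)
    then have "r powr real (card (Y s)) \<le> r powr ((1 - \<epsilon>) * real n)"
      using r expectation_sqrt_coordinate_le_1[OF P(1), of 0 z] unfolding r_def by (intro powr_mono') auto
    then show "r ^ card (Y s) \<le> r powr ((1 - \<epsilon>) * real n)"
      using r by (simp add: powr_realpow)
  qed
  also have "\<dots> = real (card S) * (r powr (1 - \<epsilon>)) ^ n"
    using r by (simp add: powr_powr[symmetric] powr_realpow)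
  also have "\<dots> \<le> (K powr \<epsilon> * (1 + real (card (unit_steps :: 'd site set)) / K)) ^ n * (r powr (1 - \<epsilon>)) ^ n"
    unfolding S_def by (intro mult_right_mono card_directed_paths_le[OF z K]) auto
  finally show ?thesis by (simp add: power_mult_distrib)
qed

text \<open>The order of choice matters: first \<open>K\<close> is taken so large that
  \<open>(1 + c / K) * r < b\<close>, and then \<open>\<epsilon>\<close>, depending on
  \<open>K\<close>, so small that \<open>K powr \<epsilon>\<close> and
  \<open>r powr (1 - \<epsilon>)\<close> are close to \<open>1\<close> and \<open>r\<close>.\<close>

lemma exists_tilting_parameters:
  fixes r b c :: real
  assumes "0 < r" "r < b"
  obtains K \<epsilon> where "1 \<le> K" "0 < \<epsilon>" "K powr \<epsilon> * (1 + c / K) * r powr (1 - \<epsilon>) < b"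
proof -
  have "((\<lambda>K. (1 + c / K) * r) \<longlongrightarrow> (1 + 0) * r) at_top"
    by (intro tendsto_intros real_tendsto_divide_at_top[OF tendsto_const filterlim_ident])
  then have "\<forall>\<^sub>F K in at_top. (1 + c / K) * r < b"
    using assms by (intro order_tendstoD) auto
  then have "\<forall>\<^sub>F K in at_top. (1 + c / K) * r < b \<and> 1 \<le> K"
    using eventually_ge_at_top[of 1] by eventually_elim auto
  then obtain K where K: "(1 + c / K) * r < b" "1 \<le> K"
    using eventually_happens' trivial_limit_at_top_linorder by blast
  have "((\<lambda>\<epsilon>. K powr \<epsilon> * (1 + c / K) * r powr (1 - \<epsilon>)) \<longlongrightarrow> K powr 0 * (1 + c / K) * r powr (1 - 0)) (at_right 0)"
    using K assms by (intro tendsto_intros) auto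
  then have "\<forall>\<^sub>F \<epsilon> in at_right 0. K powr \<epsilon> * (1 + c / K) * r powr (1 - \<epsilon>) < b"
    using K assms by (intro order_tendstoD) auto
  then have "\<forall>\<^sub>F \<epsilon> in at_right 0. K powr \<epsilon> * (1 + c / K) * r powr (1 - \<epsilon>) < b \<and> 0 < \<epsilon>"
    using eventually_at_right_less[of 0] by eventually_elim auto
  then obtain \<epsilon> where "K powr \<epsilon> * (1 + c / K) * r powr (1 - \<epsilon>) < b" "0 < \<epsilon>"
    using eventually_happens' trivial_limit_at_right_real by blast
  with K that show thesis by blast
qed

text \<open>Markov's inequality bounds the probability of the \<open>n\<close>-th exceptional event
  by \<open>(\<rho> / b) ^ n\<close>. This is summable, so the Borel-Cantelli lemma applies.\<close>

lemma AE_eventually_less_power: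
  fixes f :: "nat \<Rightarrow> 'a \<Rightarrow> real"
  assumes "prob_space M" and int: "\<And>n. integrable M (f n)"
    and nn: "\<And>n x. x \<in> space M \<Longrightarrow> 0 \<le> f n x"
    and le: "\<And>n. (\<integral>x. f n x \<partial>M) \<le> \<rho> ^ n" and \<rho>: "0 \<le> \<rho>" "\<rho> < b"
  shows "AE x in M. \<forall>\<^sub>F n in sequentially. f n x < b ^ n"
proof -
  interpret prob_space M by fact
  note [measurable] = borel_measurable_integrable[OF int]
  define A where "A n = {x \<in> space M. b ^ n \<le> f n x}" for n
  have A[measurable]: "A n \<in> sets M" for n unfolding A_def by measurable
  have "measure M (A n) \<le> (\<rho> / b) ^ n" for n
  proof -
    have "measure M (A n) \<le> (\<integral>x. f n x \<partial>M) / b ^ n"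
      unfolding A_def using \<rho> nn by (intro integral_Markov_inequality_measure[OF int]) auto
    also have "\<dots> \<le> \<rho> ^ n / b ^ n" using \<rho> le by (intro divide_right_mono) auto
    finally show ?thesis by (simp add: power_divide)
  qed
  then have "summable (\<lambda>n. measure M (A n))"
    using \<rho> by (intro summable_comparison_test'[OF summable_geometric[of "\<rho> / b"], of 0]) auto
  then have "AE x in M. \<forall>\<^sub>F n in sequentially. x \<in> space M - A n"
    by (intro borel_cantelli_AE1[OF A]) (auto simp: emeasure_eq_measure)
  then show ?thesis
    by eventually_elim (auto elim!: eventually_mono simp: A_def)
qed

lemma measurable_velocity [measurable]: "velocity n \<in> measurable path_space borel"
proof -
  have [measurable]: "(\<lambda>X. X n) \<in> measurable path_space (count_space UNIV)"
    unfolding path_space_def by (rule measurable_component_singleton) simp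
  have "(\<lambda>X :: nat \<Rightarrow> 'a site. (1 / real n) *\<^sub>R real_site (X n)) \<in> measurable path_space borel"
    by (rule measurable_compose[of "\<lambda>X. X n" _ "count_space UNIV"]) simp_all
  then show ?thesis by (simp add: velocity_eq_scaled[abs_def])
qed

lemma measure_quenched_velocity:
  assumes "G \<in> sets borel"
  shows "measure (quenched_velocity \<omega> n) G = measure (quenched_law \<omega> 0) {X. velocity n X \<in> G}"
proof -
  have "velocity n \<in> measurable (quenched_law \<omega> 0) borel"
    using measurable_velocity by (simp cong: measurable_cong_sets add: sets_quenched_law)
  then show ?thesis
    using assms unfolding quenched_velocity_def
    by (simp add: measure_distr space_quenched_law vimage_def)
qed

lemma LDP_lower_open:
  assumes "LDP Q I" "open G"
  shows "- (INF x\<in>G. I x) \<le> liminf (\<lambda>n. ereal (1 / real n) * log_ereal (measure (Q n) G))"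
  using bspec[OF conjunct2[OF assms(1)[unfolded LDP_def]] borel_open[OF assms(2)]] assms(2)
  by (simp add: interior_open)

lemma LDP_upper_closed:
  assumes "LDP Q I" "closed G"
  shows "limsup (\<lambda>n. ereal (1 / real n) * log_ereal (measure (Q n) G)) \<le> - (INF x\<in>G. I x)"
  using bspec[OF conjunct2[OF assms(1)[unfolded LDP_def]] borel_closed[OF assms(2)]] assms(2)
  by simp

text \<open>The lower LDP bound on an open half-space around \<open>real_site z\<close> bounds
  \<open>- I (real_site z)\<close> by the decay rate of its quenched probability. Almost surely the
  square root of that probability is eventually below \<open>b ^ n\<close>, whence the factor
  2.\<close>

lemma quenched_rate_ge:
  fixes P :: "'d::finite env measure"
  assumes P: "environment_law P" "iid_environment P" and z: "z \<in> unit_steps"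
    and ldp: "AE \<omega> in P. LDP (quenched_velocity \<omega>) I"
    and r: "0 < (\<integral>\<omega>. sqrt (\<omega> 0 z) \<partial>P)" "(\<integral>\<omega>. sqrt (\<omega> 0 z) \<partial>P) < b"
  shows "ereal (- 2 * ln b) \<le> I (real_site z)"
proof -
  interpret prob_space P using P by (simp add: environment_law_def)
  define r where "r = (\<integral>\<omega>. sqrt (\<omega> 0 z) \<partial>P)"
  obtain K \<epsilon> where K: "1 \<le> K" "0 < \<epsilon>"
    "K powr \<epsilon> * (1 + real (card (unit_steps :: 'd site set)) / K) * r powr (1 - \<epsilon>) < b"
    using exists_tilting_parameters[of r b "real (card (unit_steps :: 'd site set))"] r unfolding r_def by blast
  define G where "G = {\<xi> :: real ^ 'd. 1 - \<epsilon> < \<xi> \<bullet> real_site z}"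
  have G: "open G" unfolding G_def by (intro open_Collect_less continuous_intros)
  have zG: "real_site z \<in> G" using K z by (simp add: G_def inner_real_site level_self)
  define f where "f n \<omega> = sqrt (measure (quenched_law \<omega> 0)
      {X. (1 - \<epsilon>) * real n < real_of_int (level z (X n))})" for n and \<omega> :: "'d env"
  \<comment> \<open>At \<open>n = 0\<close> the velocity is \<open>0\<close> by the convention on
    division, and the two events may differ.\<close>
  have fG: "f n \<omega> = sqrt (measure (quenched_velocity \<omega> n) G)" if "0 < n" for n \<omega>
    using that G unfolding f_def
    by (subst measure_quenched_velocity)
      (auto simp: G_def velocity_eq_scaled inner_real_site field_simps)
  have "AE \<omega> in P. \<forall>\<^sub>F n in sequentially. f n \<omega> < b ^ n"
  proof (rule AE_eventually_less_power)
    show "integrable P (f n)" for n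
      unfolding f_def by (rule integrable_sqrt_quenched_event[OF P(1)])
    show "(\<integral>\<omega>. f n \<omega> \<partial>P) \<le>
        (K powr \<epsilon> * (1 + real (card (unit_steps :: 'd site set)) / K) * r powr (1 - \<epsilon>)) ^ n" for n
      unfolding f_def r_def by (rule expectation_sqrt_directed_le[OF P z K(1) r(1)])
  qed (use K in \<open>auto simp: f_def prob_space_axioms\<close>)
  with ldp have "AE \<omega> in P. ereal (- 2 * ln b) \<le> I (real_site z)"
  proof eventually_elim
    case (elim \<omega>)
    have b: "0 < b" using r by simp
    have "\<forall>\<^sub>F n in sequentially.
        ereal (1 / real n) * log_ereal (measure (quenched_velocity \<omega> n) G) \<le> ereal (2 * ln b)"
      using elim(2) eventually_gt_at_top[of 0]
    proof eventually_elim
      case (elim n)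
      let ?p = "measure (quenched_velocity \<omega> n) G"
      show ?case
      proof (cases "?p = 0")
        case False
        then have p: "0 < ?p" using measure_nonneg[of "quenched_velocity \<omega> n" G] by linarith
        then have "ln (sqrt ?p) < ln (b ^ n)" using elim fG b by simp
        then have "ln ?p \<le> real n * (2 * ln b)" using p b by (simp add: ln_sqrt ln_realpow)
        then show ?thesis using elim False by (simp add: log_ereal_def field_simps)
      \<comment> \<open>For probability zero \<open>log_ereal\<close> is minus infinity, and the
        bound is immediate.\<close>
      qed (use elim in \<open>simp add: log_ereal_def\<close>)
    qed
    then have "limsup (\<lambda>n. ereal (1 / real n) * log_ereal (measure (quenched_velocity \<omega> n) G)) \<le> ereal (2 * ln b)"
      by (rule Limsup_bounded)
    then have "liminf (\<lambda>n. ereal (1 / real n) * log_ereal (measure (quenched_velocity \<omega> n) G)) \<le> ereal (2 * ln b)"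
      using Liminf_le_Limsup[of sequentially] order_trans by fastforce
    with LDP_lower_open[OF elim(1) G] have "- (INF x\<in>G. I x) \<le> ereal (2 * ln b)"
      by (rule order_trans)
    moreover have "- I (real_site z) \<le> - (INF x\<in>G. I x)"
      using zG by (simp add: INF_lower)
    ultimately have "- I (real_site z) \<le> ereal (2 * ln b)" by (rule order_trans[rotated])
    then show ?case by (subst (asm) ereal_uminus_le_reorder) simp
  qed
  then show ?thesis by simp
qed

subsection \<open>Upper bound for the averaged rate at a unit step\<close>

lemma sets_averaged_law:
  assumes P: "environment_law P"
  shows "sets (averaged_law P x) = sets (P \<Otimes>\<^sub>M path_space)"
proof -
  interpret prob_space P using P by (simp add: environment_law_def)
  show ?thesis
    unfolding averaged_law_def using measurable_joint_kernel[OF P]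
    by (intro sets_bind) (auto dest: sets_kernel simp: not_empty)
qed

lemma measurable_averaged_velocity_map:
  assumes P: "environment_law P"
  shows "(\<lambda>(\<omega>, X). velocity n X) \<in> measurable (averaged_law P x) borel"
proof -
  have "(\<lambda>(\<omega>, X). velocity n X) \<in> measurable (P \<Otimes>\<^sub>M path_space) borel"
    by measurable
  then show ?thesis
    using sets_averaged_law[OF P] by (simp cong: measurable_cong_sets)
qed

lemma emeasure_averaged_velocity:
  fixes P :: "'d::finite env measure"
  assumes P: "environment_law P" and G: "G \<in> sets borel"
  shows "emeasure (averaged_velocity P n) G =
    (\<integral>\<^sup>+\<omega>. emeasure (quenched_law \<omega> 0) {X. velocity n X \<in> G} \<partial>P)"
proof -
  define A where "A = {p \<in> space (P \<Otimes>\<^sub>M path_space). velocity n (snd p) \<in> G}"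
  have A: "A \<in> sets (P \<Otimes>\<^sub>M path_space)"
    unfolding A_def using G by measurable
  from sets_eq_imp_space_eq[OF sets_averaged_law[OF P]]
  have "(\<lambda>(\<omega>, X). velocity n X) -` G \<inter> space (averaged_law P 0) = A"
    by (auto simp: A_def)
  then have "emeasure (averaged_velocity P n) G = emeasure (averaged_law P 0) A"
    unfolding averaged_velocity_def
    using G by (subst emeasure_distr[OF measurable_averaged_velocity_map[OF P]]) auto
  also have "\<dots> = (\<integral>\<^sup>+\<omega>. emeasure (quenched_law \<omega> 0) {X. (\<omega>, X) \<in> A} \<partial>P)"
    by (rule emeasure_averaged_law[OF P A])
  also have "\<dots> = (\<integral>\<^sup>+\<omega>. emeasure (quenched_law \<omega> 0) {X. velocity n X \<in> G} \<partial>P)"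
    by (intro nn_integral_cong arg_cong[where f = "emeasure _"])
      (auto simp: A_def space_pair_measure path_space_def space_PiM)
  finally show ?thesis .
qed

lemma position_const: "real_site (position (\<lambda>_. z) n) = real n *\<^sub>R real_site z"
proof (induction n)
  case 0
  show ?case by (simp add: real_site_def vec_eq_iff)
next
  case (Suc n)
  have "real_site (position (\<lambda>_. z) (Suc n)) = real_site (position (\<lambda>_. z) n) + real_site z"
    by (simp add: position_Suc real_site_def vec_eq_iff)
  then show ?case unfolding Suc by (simp add: scaleR_left_distrib)
qed

text \<open>Only the straight path is counted. It takes its \<open>n\<close> steps from distinct
  sites, so the mean of its quenched probability is a power of the one-site mean.\<close>

lemma measure_averaged_velocity_unit_step_ge:
  fixes P :: "'d::finite env measure"
  assumes P: "environment_law P" "iid_environment P" and z: "z \<in> unit_steps" and n: "0 < n"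
  shows "(\<integral>\<omega>. \<omega> 0 z \<partial>P) ^ n \<le> measure (averaged_velocity P n) {real_site z}"
proof -
  interpret prob_space P using P by (simp add: environment_law_def)
  let ?p = "position (\<lambda>_. z)"
  have "level z (?p i) = int i" for i
    using z by (induction i) (simp_all add: position_Suc level_add level_self)
  then have inj: "inj_on ?p {..<n}"
    by (metis inj_onI of_nat_eq_iff)
  have prod: "(\<Prod>i<n. \<omega> (?p i) z) = (\<Prod>y\<in>?p ` {..<n}. \<omega> y z)" for \<omega> :: "'d env"
    using inj by (simp add: prod.reindex)
  note iid = iid_expectation_prod[OF P measurable_ident_sets[OF refl] integrable_coordinate(1)[OF P(1)],
      of "?p ` {..<n}" z]
  have "ennreal ((\<integral>\<omega>. \<omega> 0 z \<partial>P) ^ n) = ennreal (\<integral>\<omega>. (\<Prod>i<n. \<omega> (?p i) z) \<partial>P)"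
    unfolding prod using iid(2) inj by (simp add: card_image)
  also have "\<dots> = (\<integral>\<^sup>+\<omega>. ennreal (\<Prod>i<n. \<omega> (?p i) z) \<partial>P)"
    unfolding prod using iid(1) space_environment_law[OF P(1)]
    by (intro nn_integral_eq_integral[symmetric] AE_I2) (auto intro!: prod_nonneg simp: environment_nonneg)
  also have "\<dots> \<le> (\<integral>\<^sup>+\<omega>. emeasure (quenched_law \<omega> 0) {X. velocity n X \<in> {real_site z}} \<partial>P)"
  proof (rule nn_integral_mono)
    fix \<omega> assume "\<omega> \<in> space P"
    then have \<omega>: "\<omega> \<in> environments" by (simp add: space_environment_law[OF P(1)])
    have "ennreal (\<Prod>i<n. \<omega> (?p i) z) = emeasure (quenched_law \<omega> 0) {X. \<forall>i\<le>n. X i = ?p i}"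
      unfolding emeasure_quenched_law[OF \<omega>] by (simp add: position_Suc)
    also have "\<dots> \<le> emeasure (quenched_law \<omega> 0) {X. velocity n X \<in> {real_site z}}"
    proof (rule emeasure_mono)
      show "{X. \<forall>i\<le>n. X i = ?p i} \<subseteq> {X. velocity n X \<in> {real_site z}}"
        using n by (auto simp: velocity_eq_scaled position_const)
      show "{X. velocity n X \<in> {real_site z}} \<in> sets (quenched_law \<omega> 0)"
        unfolding velocity_eq_scaled by (rule sets_path_event)
    qed
    finally show "ennreal (\<Prod>i<n. \<omega> (?p i) z) \<le>
        emeasure (quenched_law \<omega> 0) {X. velocity n X \<in> {real_site z}}" .
  qed
  also have "\<dots> = emeasure (averaged_velocity P n) {real_site z}"
    by (rule emeasure_averaged_velocity[OF P(1), symmetric]) simp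
  finally have le: "ennreal ((\<integral>\<omega>. \<omega> 0 z \<partial>P) ^ n) \<le> emeasure (averaged_velocity P n) {real_site z}" .
  \<comment> \<open>Finiteness is what allows the passage from \<open>emeasure\<close> to
    \<open>measure\<close>, which would be \<open>0\<close> on a set of infinite mass.\<close>
  have "emeasure (averaged_velocity P n) {real_site z} \<le> (\<integral>\<^sup>+\<omega>. 1 \<partial>P)"
    unfolding emeasure_averaged_velocity[OF P(1) borel_singleton[OF sets.empty_sets]]
    by (intro nn_integral_mono prob_space.measure_le_1 prob_space_quenched_law)
  also have "\<dots> < top" by (simp add: emeasure_space_1)
  finally have "emeasure (averaged_velocity P n) {real_site z} < top" .
  with le show ?thesis
    by (simp add: emeasure_eq_ennreal_measure)
qed

text \<open>A singleton is closed, so the upper LDP bound turns its mass of at least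
  \<open>q ^ n\<close> into an upper bound for the rate at that very point.\<close>

lemma averaged_rate_le:
  fixes P :: "'d::finite env measure"
  assumes P: "environment_law P" "iid_environment P" and z: "z \<in> unit_steps"
    and ldp: "LDP (averaged_velocity P) I" and q: "0 < (\<integral>\<omega>. \<omega> 0 z \<partial>P)"
  shows "I (real_site z) \<le> ereal (- ln (\<integral>\<omega>. \<omega> 0 z \<partial>P))"
proof -
  define q where "q = (\<integral>\<omega>. \<omega> 0 z \<partial>P)"
  have "\<forall>\<^sub>F n in sequentially. ereal (ln q) \<le>
      ereal (1 / real n) * log_ereal (measure (averaged_velocity P n) {real_site z})"
    using eventually_gt_at_top[of 0]
  proof eventually_elim
    case (elim n)
    let ?p = "measure (averaged_velocity P n) {real_site z}"
    have le: "q ^ n \<le> ?p"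
      using measure_averaged_velocity_unit_step_ge[OF P z elim] by (simp add: q_def)
    have qn: "0 < q ^ n" using q by (simp add: q_def)
    then have "ln (q ^ n) \<le> ln ?p" using le by (intro ln_mono) auto
    then have "real n * ln q \<le> ln ?p" using q by (simp add: ln_realpow q_def)
    moreover have "?p \<noteq> 0" using qn le by linarith
    ultimately show ?case using elim by (simp add: log_ereal_def field_simps)
  qed
  then have "ereal (ln q) \<le> liminf (\<lambda>n. ereal (1 / real n) * log_ereal (measure (averaged_velocity P n) {real_site z}))"
    by (rule Liminf_bounded)
  also have "\<dots> \<le> limsup (\<lambda>n. ereal (1 / real n) * log_ereal (measure (averaged_velocity P n) {real_site z}))"
    by (rule Liminf_le_Limsup) simp
  also have "\<dots> \<le> - (INF x\<in>{real_site z}. I x)"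
    by (rule LDP_upper_closed[OF ldp]) simp
  finally have "ereal (ln q) \<le> - I (real_site z)" by simp
  then have "I (real_site z) \<le> - ereal (ln q)" by (metis ereal_minus_le_minus ereal_uminus_uminus)
  then show ?thesis by (simp add: q_def)
qed

subsection \<open>Strict inequality\<close>

text \<open>The logarithmic bounds on both rates require positive means; at the opposite step the
  first one yields a finite upper bound for the averaged rate.\<close>

lemma uniformly_elliptic_integral_pos:
  assumes P: "environment_law P" "uniformly_elliptic P" and z: "z \<in> unit_steps"
  shows "0 < (\<integral>\<omega>. \<omega> 0 z \<partial>P)" "0 < (\<integral>\<omega>. sqrt (\<omega> 0 z) \<partial>P)"
proof -
  interpret prob_space P using P by (simp add: environment_law_def)
  note [measurable] = measurable_coordinate_environment_law[OF P(1)]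
  obtain \<delta> where \<delta>: "0 < \<delta>" "prob {\<omega> \<in> space P. \<delta> \<le> \<omega> 0 z} = 1"
    using P(2) z unfolding uniformly_elliptic_def by blast
  then have ae: "AE \<omega> in P. \<delta> \<le> \<omega> 0 z" by (subst (asm) prob_Collect_eq_1) measurable
  have "(\<integral>\<omega>. \<delta> \<partial>P) \<le> (\<integral>\<omega>. \<omega> 0 z \<partial>P)"
    using ae by (intro integral_mono_AE integrable_coordinate[OF P(1)]) auto
  with \<delta> show "0 < (\<integral>\<omega>. \<omega> 0 z \<partial>P)" by (simp add: prob_space)
  have "(\<integral>\<omega>. sqrt \<delta> \<partial>P) \<le> (\<integral>\<omega>. sqrt (\<omega> 0 z) \<partial>P)"
    using ae by (intro integral_mono_AE integrable_coordinate[OF P(1)]) auto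
  with \<delta> show "0 < (\<integral>\<omega>. sqrt (\<omega> 0 z) \<partial>P)"
    using real_sqrt_gt_zero[OF \<delta>(1)] by (simp add: prob_space del: real_sqrt_gt_0_iff)
qed

text \<open>The hypothesis is the equality case of Jensen's inequality: it makes the variance of
  \<open>sqrt (\<omega> 0 z)\<close> vanish. Equality of the one-site laws carries the result from
  the origin to \<open>x\<close>.\<close>

lemma AE_coordinate_const:
  assumes P: "environment_law P" "iid_environment P"
    and eq: "(\<integral>\<omega>. \<omega> 0 z \<partial>P) \<le> (\<integral>\<omega>. sqrt (\<omega> 0 z) \<partial>P)\<^sup>2"
  shows "AE \<omega> in P. \<omega> x z = (\<integral>\<omega>. sqrt (\<omega> 0 z) \<partial>P)\<^sup>2"
proof -
  interpret prob_space P using P by (simp add: environment_law_def)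
  note [measurable] = measurable_coordinate_environment_law[OF P(1)]
  define m where "m = (\<integral>\<omega>. sqrt (\<omega> 0 z) \<partial>P)"
  have expand: "(sqrt (\<omega> 0 z) - m)\<^sup>2 = \<omega> 0 z - 2 * m * sqrt (\<omega> 0 z) + m\<^sup>2"
    if "\<omega> \<in> space P" for \<omega>
    using that environment_nonneg[of \<omega> 0 z] space_environment_law[OF P(1)]
    by (simp add: power2_diff)
  have int: "integrable P (\<lambda>\<omega>. (sqrt (\<omega> 0 z) - m)\<^sup>2)"
    using integrable_coordinate[OF P(1)] by (subst Bochner_Integration.integrable_cong[OF refl expand]) auto
  have "(\<integral>\<omega>. (sqrt (\<omega> 0 z) - m)\<^sup>2 \<partial>P) = (\<integral>\<omega>. \<omega> 0 z - 2 * m * sqrt (\<omega> 0 z) + m\<^sup>2 \<partial>P)"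
    by (rule Bochner_Integration.integral_cong[OF refl expand])
  also have "\<dots> = (\<integral>\<omega>. \<omega> 0 z \<partial>P) - 2 * m * m + m\<^sup>2"
    using integrable_coordinate[OF P(1)] by (simp add: m_def prob_space)
  also have "\<dots> \<le> 0" using eq by (simp add: m_def power2_eq_square)
  finally have "(\<integral>\<omega>. (sqrt (\<omega> 0 z) - m)\<^sup>2 \<partial>P) = 0"
    by (intro antisym integral_nonneg_AE) auto
  then have "AE \<omega> in P. (sqrt (\<omega> 0 z) - m)\<^sup>2 = 0"
    using int by (subst (asm) integral_nonneg_eq_0_iff_AE) auto
  then have "AE \<omega> in P. \<omega> 0 z = m\<^sup>2"
    using AE_space
  proof eventually_elim
    case (elim \<omega>)
    then have "0 \<le> \<omega> 0 z" "sqrt (\<omega> 0 z) = m"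
      using environment_nonneg[of \<omega> 0 z] space_environment_law[OF P(1)] by auto
    then show ?case by (metis real_sqrt_pow2)
  qed
  then have "AE v in distr P borel (\<lambda>\<omega>. \<omega> 0 z). v = m\<^sup>2"
    by (subst AE_distr_iff) auto
  then have "AE v in distr P borel (\<lambda>\<omega>. \<omega> x z). v = m\<^sup>2"
    by (simp only: distr_coordinate_eq[OF P, of x z])
  then show ?thesis by (subst (asm) AE_distr_iff) (auto simp: m_def)
qed

text \<open>Otherwise every coordinate is almost surely constant. There are countably many
  coordinates, so the whole environment is, which contradicts the assumption on the support.\<close>

lemma exists_nondegenerate_step:
  fixes P :: "'d::finite env measure"
  assumes P: "environment_law P" "iid_environment P"
    and nontriv: "\<not> is_singleton (topological_support P)"
  shows "\<exists>z\<in>unit_steps. (\<integral>\<omega>. sqrt (\<omega> 0 z) \<partial>P)\<^sup>2 < (\<integral>\<omega>. \<omega> 0 z \<partial>P)"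
proof (rule ccontr)
  assume "\<not> ?thesis"
  then have le: "(\<integral>\<omega>. \<omega> 0 z \<partial>P) \<le> (\<integral>\<omega>. sqrt (\<omega> 0 z) \<partial>P)\<^sup>2" if "z \<in> unit_steps" for z
    using that by (simp add: not_less)
  \<comment> \<open>The value \<open>0\<close> off the unit steps matches the encoding of
    environments.\<close>
  define \<omega>' :: "'d env"
    where "\<omega>' x z = (if z \<in> unit_steps then (\<integral>\<omega>. sqrt (\<omega> 0 z) \<partial>P)\<^sup>2 else 0)" for x z
  have "AE \<omega> in P. \<omega> x z = \<omega>' x z" for x z
  proof (cases "z \<in> unit_steps")
    case True
    then show ?thesis using AE_coordinate_const[OF P le[OF True], of x] by (simp add: \<omega>'_def)
  next
    case False
    then show ?thesis
      by (intro AE_I2) (auto simp: space_environment_law[OF P(1)] environments_def \<omega>'_def)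
  qed
  then have "AE \<omega> in P. \<forall>x z. \<omega> x z = \<omega>' x z"
    by (simp add: AE_all_countable)
  then have "AE \<omega> in P. \<omega> = \<omega>'" by eventually_elim auto
  from topological_support_point_mass[OF P(1) this] nontriv show False
    by (simp add: is_singleton_def)
qed

text \<open>Convexity keeps \<open>I\<close> below the chord between its finite bounds at
  \<open>- e\<close> and \<open>e\<close>, which tends to \<open>a\<close> near \<open>e\<close>.
  Lower semicontinuity keeps \<open>J\<close> above some \<open>m\<close> strictly between
  \<open>a\<close> and \<open>b\<close>.\<close>

lemma convex_lsc_strict_on_segment:
  fixes I J :: "'a::real_normed_vector \<Rightarrow> ereal" and c :: real
  assumes conv: "convex_ereal I" and lsc: "rate_function J" and e: "e \<noteq> 0"
    and I: "I (- e) \<le> ereal c" "I e \<le> ereal a" and J: "ereal b \<le> J e" and "a < b"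
  obtains t where "\<bar>t\<bar> < 1" "I (t *\<^sub>R e) < J (t *\<^sub>R e)"
proof -
  define h where "h t = (2 * t - 1) *\<^sub>R e" for t :: real
  obtain m where m: "a < m" "m < b" using \<open>a < b\<close> dense by blast
  have "ereal m < Liminf (at e) J"
    using m J lsc unfolding rate_function_def by (metis ereal_less_eq(3) less_ereal.simps(1) less_le_trans order.trans)
  then have ev: "\<forall>\<^sub>F x in at e. ereal m < J x" by (rule less_LiminfD)
  \<comment> \<open>The filter \<open>at e\<close> in the definition of a rate function leaves out
    \<open>e\<close> itself, so the segment must avoid that point.\<close>
  have "h t \<noteq> e" if "t < 1" for t
    using that e scaleR_cancel_right[of "2 * t - 1" e 1] by (simp add: h_def)
  then have ne: "\<forall>\<^sub>F t in at_left 1. h t \<noteq> e"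
    by (intro eventually_at_leftI[of 0 1]) auto
  have "(h \<longlongrightarrow> (2 * 1 - 1) *\<^sub>R e) (at_left 1)"
    unfolding h_def by (intro tendsto_intros)
  then have "filterlim h (at e) (at_left 1)"
    using ne by (simp add: filterlim_at)
  then have J': "\<forall>\<^sub>F t in at_left 1. ereal m < J (h t)"
    using ev by (rule filterlim_iff[THEN iffD1, rule_format])
  have "((\<lambda>t. (1 - t) * c + t * a) \<longlongrightarrow> (1 - 1) * c + 1 * a) (at_left 1)"
    by (intro tendsto_intros)
  then have "\<forall>\<^sub>F t in at_left 1. (1 - t) * c + t * a < m"
    using m by (intro order_tendstoD) auto
  moreover have "\<forall>\<^sub>F t in at_left (1::real). 0 < t \<and> t < 1"
    using eventually_at_leftI[of 0 1 "\<lambda>t. 0 < t \<and> t < (1::real)"] by auto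
  ultimately have "\<forall>\<^sub>F t in at_left 1. \<bar>2 * t - 1\<bar> < 1 \<and> I (h t) < J (h t)"
    using J'
  proof eventually_elim
    case (elim t)
    have "I (h t) = I ((1 - t) *\<^sub>R (- e) + t *\<^sub>R e)"
      by (simp add: h_def algebra_simps flip: scaleR_add_left)
    also have "\<dots> \<le> ereal (1 - t) * I (- e) + ereal t * I e"
      using conv[unfolded convex_ereal_def, rule_format, of t "- e" e] elim by simp
    also have "\<dots> \<le> ereal (1 - t) * ereal c + ereal t * ereal a"
      using elim I by (intro add_mono ereal_mult_left_mono) auto
    also have "\<dots> < ereal m" using elim by simp
    finally show ?case using elim by auto
  qed
  then obtain t where "\<bar>2 * t - 1\<bar> < 1" "I (h t) < J (h t)"
    using eventually_happens' trivial_limit_at_left_real by blast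
  then show thesis using that unfolding h_def by blast
qed

theorem proposition4:
  fixes P :: "'d::finite env measure" and I_q I_a :: "real ^ 'd \<Rightarrow> ereal"
  assumes "environment_law P"
    and "uniformly_elliptic P"
    and "iid_environment P"
    and "\<not> is_singleton (topological_support P)"
    and "quenched_rate_function P I_q"
    and "averaged_rate_function P I_a"
  shows "\<exists>\<xi>\<in>interior velocity_domain. I_a \<xi> < I_q \<xi>"
proof -
  interpret prob_space P using assms by (simp add: environment_law_def)
  obtain z where z: "z \<in> unit_steps"
    and nondeg: "(\<integral>\<omega>. sqrt (\<omega> 0 z) \<partial>P)\<^sup>2 < (\<integral>\<omega>. \<omega> 0 z \<partial>P)"
    using exists_nondegenerate_step assms by blast
  define q where "q = (\<integral>\<omega>. \<omega> 0 z \<partial>P)"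
  have q: "0 < q" unfolding q_def by (rule uniformly_elliptic_integral_pos[OF assms(1,2) z])
  have "(\<integral>\<omega>. sqrt (\<omega> 0 z) \<partial>P) < sqrt q"
    using nondeg unfolding q_def by (rule real_less_rsqrt)
  \<comment> \<open>The gap is used on both sides: \<open>b\<close> above the mean gives the
    geometric decay in the quenched bound, and \<open>b < sqrt q\<close> gives
    \<open>- ln q < - 2 * ln b\<close>.\<close>
  then obtain b where b: "(\<integral>\<omega>. sqrt (\<omega> 0 z) \<partial>P) < b" "b < sqrt q"
    using dense by blast
  have r: "0 < (\<integral>\<omega>. sqrt (\<omega> 0 z) \<partial>P)"
    by (rule uniformly_elliptic_integral_pos[OF assms(1,2) z])
  have ldp_q: "AE \<omega> in P. LDP (quenched_velocity \<omega>) I_q"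
    using assms(5) by (simp add: quenched_rate_function_def)
  then have "AE \<omega> in P. rate_function I_q" by eventually_elim (simp add: LDP_def)
  then have lsc: "rate_function I_q" by simp
  have a: "convex_ereal I_a" "LDP (averaged_velocity P) I_a"
    using assms(6) by (simp_all add: averaged_rate_function_def)
  \<comment> \<open>The opposite step supplies the other end of the segment, where only a finite
    bound on \<open>I_a\<close> is required.\<close>
  note uz = uminus_unit_steps[OF z]
  have "ln b < ln (sqrt q)" using b r q by simp
  then have "- ln q < - 2 * ln b" using q by (simp add: ln_sqrt)
  moreover have "real_site z \<noteq> 0"
    using sum_abs_real_site[OF z] by auto
  ultimately obtain t where "\<bar>t\<bar> < 1" "I_a (t *\<^sub>R real_site z) < I_q (t *\<^sub>R real_site z)"
    using convex_lsc_strict_on_segment[OF a(1) lsc]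
      averaged_rate_le[OF assms(1,3) z a(2)] averaged_rate_le[OF assms(1,3) uz a(2)]
      uniformly_elliptic_integral_pos(1)[OF assms(1,2) uz] q
      quenched_rate_ge[OF assms(1,3) z ldp_q r b(1)]
    unfolding q_def real_site_uminus by metis
  then show ?thesis
    using scaled_unit_step_in_interior[OF z] by blast
qed

end
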